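(* Let $k\ge0$ be an integer, let $\theta(\cdot)\in\Theta_{k+1}(L)$, and let $\varphi_\epsilon=\epsilon^{\gamma}$ with $\gamma=\frac{1}{(k+2)-\frac1\alpha}$. Let $G$ be a bounded function satisfying conditions $(A_2)$ and $(A_3)$, and let $\widehat{\theta}_tX_t$ be the associated kernel estimator (see context). Let $0<t<T$. Then, as $\epsilon\to0$, $$\varphi_\epsilon^{-(k+1)}\big(\widehat{\theta}_tX_t-\theta(t)x_t\big)$$ converges in distribution to the random variable $$\Big(\int_{-\infty}^{\infty}G(u)_+^{\alpha}\,du\Big)^{1/\alpha}U_1-\Big(\int_{-\infty}^{\infty}G(u)_-^{\alpha}\,du\Big)^{1/\alpha}U_2+m,$$ where $U_1$ and $U_2$ are independent random variables, each with the $\alpha$-stable distribution $S_\alpha(1,\beta,0)$, $G(u)_+$ and $G(u)_-$ are the positive and negative parts of $G(u)$, and $$m=\frac{J^{(k+1)}(t)}{(k+1)!}\int_{-\infty}^{\infty}G(u)u^{k+1}\,du,\qquad J(t)=\theta(t)x_t .$$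
   Context: **Noise.** A random variable $Z$ has the stable law $S_\alpha(\sigma,\beta,\mu)$ (with $\alpha\neq 1$, $\alpha\in(0,2]$, $\sigma>0$, $\beta\in[-1,1]$, $\mu\in\mathbb{R}$) if $E[e^{iuZ}]=\exp\{-\sigma^\alpha|u|^\alpha(1-i\beta\,\mathrm{sgn}(u)\tan(\alpha\pi/2))+i\mu u\}$. Throughout $1<\alpha<2$ and $\beta\in[-1,1]$ are fixed. On a probability space $(\Omega,\mathcal{F},P)$ with a right-continuous filtration $\{\mathcal{F}_t\}$, $Z=\{Z_t,t\ge0\}$ is a standard $\alpha$-stable Lévy process: adapted (càdlàg), $Z_0=0$ a.s., with independent increments, and $Z_t-Z_s\sim S_\alpha((t-s)^{1/\alpha},\beta,0)$ for $0\le s<t$. **Model.** Fix $T>0$, $x_0\in\mathbb{R}$. For $\epsilon>0$ and a function $\theta$, $X=\{X_t,0\le t\le T\}$ solves $dX_t=\theta(t)X_t\,dt+\epsilon\,dZ_t$, $X_0=x_0$, $0\le t\le T$. The function $x_t$ solves $dx_t/dt=\theta(t)x_t$ with initial value $x_0$, i.e. $x_t=x_0\exp(\int_0^t\theta(s)ds)$. **Condition $(A_1)$ and function class.** $(A_1)$: $|\theta(t)|\le L$ for all $t\in[0,T]$. Fix constants $L,L'>0$. For an integer $j\ge0$, $\Theta_j(L)$ is the class of all functions $\theta$ which satisfy $(A_1)$ with this $L$, are $j$ times differentiable, and satisfy $|\theta^{(j)}(x)-\theta^{(j)}(y)|\le L'|x-y|$ for all $x,y\in\mathbb{R}$, where $\theta^{(0)}=\theta$.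 **Condition $(A_2)$.** $G:\mathbb{R}\to\mathbb{R}$ is bounded (measurable), there are $A<0<B$ with $G(u)=0$ for $u<A$ and $u>B$, and $\int_A^B G(u)\,du=1$. **Condition $(A_3)$.** $\int_{-\infty}^\infty u^jG(u)\,du=0$ for $j=1,2,\dots,k$. **Estimator.** The quantity $\widehat{\theta}_tX_t$ is defined by $$\widehat{\theta}_tX_t=\frac1{\varphi_\epsilon}\int_0^T G\Big(\frac{\tau-t}{\varphi_\epsilon}\Big)\,dX_\tau .$$ *)

theory Defs
  imports "HOL-Probability.Probability"
begin

section \<open>Stable laws and the driving noise\<close>

text \<open>The law \<open>S\<^sub>\<alpha>(\<sigma>, \<beta>, \<mu>)\<close> by its characteristic function; the formula is the one for \<open>\<alpha> \<noteq> 1\<close>.\<close>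

definition has_stable_law ::
    "'a measure \<Rightarrow> ('a \<Rightarrow> real) \<Rightarrow> real \<Rightarrow> real \<Rightarrow> real \<Rightarrow> real \<Rightarrow> bool" where
  "has_stable_law M Y \<alpha> \<sigma> \<beta> \<mu> \<longleftrightarrow>
     Y \<in> borel_measurable M \<and>
     (\<forall>u. char (distr M borel Y) u =
        exp (- complex_of_real (\<sigma> powr \<alpha> * \<bar>u\<bar> powr \<alpha>) *
               (1 - \<i> * complex_of_real (\<beta> * sgn u * tan (\<alpha> * pi / 2)))
             + \<i> * complex_of_real (\<mu> * u)))"

text \<open>Time is the half-line \<open>[0, \<infinity>)\<close>. The library's filtrations are indexed by a whole type, here
  \<^typ>\<open>real\<close>; the members with negative index carry no information, since every filtration on the
  half-line extends to negative times by its member at time 0.\<close>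

definition right_continuous_filtration :: "'a measure \<Rightarrow> (real \<Rightarrow> 'a measure) \<Rightarrow> bool" where
  "right_continuous_filtration M F \<longleftrightarrow>
     filtration (space M) F \<and>
     (\<forall>t\<ge>0. subalgebra M (F t)) \<and>
     (\<forall>t\<ge>0. sets (F t) = (\<Inter>s\<in>{t<..}. sets (F s)))"

text \<open>At an endpoint of the interval \<open>I\<close> the one-sided filter that leaves \<open>I\<close> is trivial, so that
  only the one-sided condition that makes sense is imposed there.\<close>

definition cadlag_on :: "real set \<Rightarrow> (real \<Rightarrow> real) \<Rightarrow> bool" where
  "cadlag_on I f \<longleftrightarrow>
     (\<forall>t\<in>I. (f \<longlongrightarrow> f t) (at t within (I \<inter> {t<..})) \<and>
            (\<exists>l. (f \<longlongrightarrow> l) (at t within (I \<inter> {..<t}))))"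

definition independent_increments :: "'a measure \<Rightarrow> (real \<Rightarrow> 'a \<Rightarrow> real) \<Rightarrow> bool" where
  "independent_increments M Z \<longleftrightarrow>
     (\<forall>(n::nat) (s::nat \<Rightarrow> real). 0 \<le> s 0 \<and> (\<forall>i<n. s i < s (Suc i)) \<longrightarrow>
        prob_space.indep_vars M (\<lambda>_. borel) (\<lambda>i \<omega>. Z (s (Suc i)) \<omega> - Z (s i) \<omega>) {..<n})"

definition standard_stable_levy ::
    "'a measure \<Rightarrow> (real \<Rightarrow> 'a measure) \<Rightarrow> real \<Rightarrow> real \<Rightarrow> (real \<Rightarrow> 'a \<Rightarrow> real) \<Rightarrow> bool" where
  "standard_stable_levy M F \<alpha> \<beta> Z \<longleftrightarrow>
     (\<forall>t\<ge>0. Z t \<in> borel_measurable (F t)) \<and>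
     (AE \<omega> in M. cadlag_on {0..} (\<lambda>t. Z t \<omega>)) \<and>
     (AE \<omega> in M. Z 0 \<omega> = 0) \<and>
     independent_increments M Z \<and>
     (\<forall>s t. 0 \<le> s \<and> s < t \<longrightarrow>
        has_stable_law M (\<lambda>\<omega>. Z t \<omega> - Z s \<omega>) \<alpha> ((t - s) powr (1 / \<alpha>)) \<beta> 0)"

section \<open>The model\<close>

text \<open>\<open>dX\<^sub>t = \<theta>(t) X\<^sub>t dt + \<epsilon> dZ\<^sub>t\<close>, \<open>X\<^sub>0 = x\<^sub>0\<close>, in integrated form on \<open>[0, T]\<close>.\<close>

definition solves_sde ::
    "'a measure \<Rightarrow> (real \<Rightarrow> 'a measure) \<Rightarrow> real \<Rightarrow> (real \<Rightarrow> real) \<Rightarrow> real \<Rightarrow> real \<Rightarrow>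
     (real \<Rightarrow> 'a \<Rightarrow> real) \<Rightarrow> (real \<Rightarrow> 'a \<Rightarrow> real) \<Rightarrow> bool" where
  "solves_sde M F T \<theta> x0 \<epsilon> Z X \<longleftrightarrow>
     (\<forall>t\<in>{0..T}. X t \<in> borel_measurable (F t)) \<and>
     (AE \<omega> in M. cadlag_on {0..T} (\<lambda>t. X t \<omega>)) \<and>
     (AE \<omega> in M. \<forall>t\<in>{0..T}.
        X t \<omega> = x0 + (LINT s:{0..t}|lborel. \<theta> s * X s \<omega>) + \<epsilon> * Z t \<omega>)"

definition ode_solution :: "(real \<Rightarrow> real) \<Rightarrow> real \<Rightarrow> real \<Rightarrow> real" where
  "ode_solution \<theta> x0 t = x0 * exp (LINT s:{0..t}|lborel. \<theta> s)"

definition Theta_class :: "real \<Rightarrow> real \<Rightarrow> real \<Rightarrow> nat \<Rightarrow> (real \<Rightarrow> real) set" where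
  "Theta_class T L L' j =
     {\<theta>. (\<forall>t\<in>{0..T}. \<bar>\<theta> t\<bar> \<le> L) \<and>
          (\<forall>i<j. \<forall>x. (deriv ^^ i) \<theta> field_differentiable at x) \<and>
          (\<forall>x y. \<bar>(deriv ^^ j) \<theta> x - (deriv ^^ j) \<theta> y\<bar> \<le> L' * \<bar>x - y\<bar>)}"

section \<open>Kernels\<close>

definition kernel_A2 :: "(real \<Rightarrow> real) \<Rightarrow> bool" where
  "kernel_A2 G \<longleftrightarrow>
     G \<in> borel_measurable borel \<and> bounded (range G) \<and>
     (\<exists>A B. A < 0 \<and> 0 < B \<and> (\<forall>u. u < A \<or> B < u \<longrightarrow> G u = 0) \<and>
            (LINT u:{A..B}|lborel. G u) = 1)"

definition kernel_A3 :: "nat \<Rightarrow> (real \<Rightarrow> real) \<Rightarrow> bool" where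
  "kernel_A3 k G \<longleftrightarrow> (\<forall>j\<in>{1..k}. (LINT u|lborel. u ^ j * G u) = 0)"

section \<open>Stochastic integrals of deterministic functions\<close>

definition converges_in_prob ::
    "'a measure \<Rightarrow> (nat \<Rightarrow> 'a \<Rightarrow> real) \<Rightarrow> ('a \<Rightarrow> real) \<Rightarrow> bool" where
  "converges_in_prob M Y Y' \<longleftrightarrow>
     (\<forall>e>0. (\<lambda>n. measure M {\<omega>\<in>space M. \<bar>Y n \<omega> - Y' \<omega>\<bar> > e}) \<longlonglongrightarrow> 0)"

definition step_fun :: "nat \<Rightarrow> (nat \<Rightarrow> real) \<Rightarrow> (nat \<Rightarrow> real) \<Rightarrow> real \<Rightarrow> real" where
  "step_fun N p c u = (\<Sum>i<N. c i * indicator {p i<..p (Suc i)} u)"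

definition step_integral ::
    "nat \<Rightarrow> (nat \<Rightarrow> real) \<Rightarrow> (nat \<Rightarrow> real) \<Rightarrow> (real \<Rightarrow> 'a \<Rightarrow> real) \<Rightarrow> 'a \<Rightarrow> real" where
  "step_integral N p c X \<omega> = (\<Sum>i<N. c i * (X (p (Suc i)) \<omega> - X (p i) \<omega>))"

text \<open>\<open>Y\<close> is a version of \<open>\<integral>\<^sub>0\<^sup>T f(\<tau>) dX\<^sub>\<tau>\<close>: the limit in probability of the elementary integrals of
  step functions that approximate \<open>f\<close> in \<open>L\<^sup>\<alpha>([0, T])\<close>. This is the usual construction for an
  \<open>\<alpha>\<close>-stable integrator; as \<open>\<alpha> > 1\<close>, convergence in \<open>L\<^sup>\<alpha>([0, T])\<close> implies convergence in
  \<open>L\<^sup>1([0, T])\<close>, so that it also covers a solution of the equation above, i.e. a stable process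
  plus a drift with bounded density. The integral is determined up to almost sure equality only,
  hence a relation instead of a function.\<close>

definition has_stoch_integral ::
    "'a measure \<Rightarrow> real \<Rightarrow> real \<Rightarrow> (real \<Rightarrow> real) \<Rightarrow> (real \<Rightarrow> 'a \<Rightarrow> real) \<Rightarrow> ('a \<Rightarrow> real) \<Rightarrow> bool" where
  "has_stoch_integral M \<alpha> T f X Y \<longleftrightarrow>
     Y \<in> borel_measurable M \<and>
     (\<exists>N p c.
        (\<forall>n. 0 \<le> p n 0 \<and> p n (N n) \<le> T \<and> (\<forall>i<N n. p n i \<le> p n (Suc i))) \<and>
        (\<lambda>n. \<integral>\<^sup>+u\<in>{0..T}. ennreal (\<bar>step_fun (N n) (p n) (c n) u - f u\<bar> powr \<alpha>) \<partial>lborel)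
          \<longlonglongrightarrow> 0 \<and>
        converges_in_prob M (\<lambda>n. step_integral (N n) (p n) (c n) X) Y)"

text \<open>\<open>E\<close> is a version of the random variable that is written as the product of the estimate of
  \<open>\<theta>(t)\<close> and \<open>X\<^sub>t\<close>; \<open>h\<close> is the bandwidth.\<close>

definition is_kernel_estimator ::
    "'a measure \<Rightarrow> real \<Rightarrow> real \<Rightarrow> (real \<Rightarrow> real) \<Rightarrow> real \<Rightarrow> real \<Rightarrow>
     (real \<Rightarrow> 'a \<Rightarrow> real) \<Rightarrow> ('a \<Rightarrow> real) \<Rightarrow> bool" where
  "is_kernel_estimator M \<alpha> T G h t X E \<longleftrightarrow>
     (\<exists>Y. has_stoch_integral M \<alpha> T (\<lambda>\<tau>. G ((\<tau> - t) / h)) X Y \<and>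
          (\<forall>\<omega>\<in>space M. E \<omega> = 1 / h * Y \<omega>))"

end

theory Submission
  imports Defs
begin

text \<open>Integrating \<open>G((\<tau> - t) / h)\<close> against \<open>dX = \<theta> X d\<tau> + \<epsilon> dZ\<close> splits the estimator, divided by the
  rate \<open>h\<^sup>k\<^sup>+\<^sup>1\<close>, into a drift part and a noise part.

  By Gronwall, \<open>X - x = O(\<epsilon>)\<close> uniformly on \<open>[0, T]\<close> on almost every path, which is
  \<open>o(h\<^sup>k\<^sup>+\<^sup>1)\<close> because \<open>\<epsilon> / h\<^sup>k\<^sup>+\<^sup>1\<close> is a positive power of \<open>h\<close>. In the drift part \<open>X\<close> may therefore be
  replaced by \<open>x\<close>, and a Taylor expansion of \<open>J\<close> together with the vanishing moments of \<open>G\<close> leaves \<open>m\<close>.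

  The noise part is the limit in probability of sums of independent stable increments, so its
  characteristic function is \<open>exp (- \<integral>\<psi>(u G))\<close> after rescaling, where \<open>\<psi>\<close> is the exponent of the
  standard stable law. For all small \<open>h\<close> this is exactly the characteristic function
  of the stable part of the limit, since \<open>\<psi>(u G) = G\<^sub>+\<^sup>\<alpha> \<psi>(u) + G\<^sub>-\<^sup>\<alpha> \<psi>(- u)\<close>. The two parts need not
  be independent, because the drift part has a constant limit; Levy's continuity theorem concludes.\<close>

section \<open>The exponent of a stable law\<close>

text \<open>The bandwidth exponent is where bias and noise balance: the noise in the estimator has
  scale \<open>\<epsilon> * h powr (1 / \<alpha> - 1)\<close>, the bias is of order
  \<open>h ^ (k + 1)\<close>, and equating them gives
  \<open>\<epsilon> = h powr (k + 2 - 1 / \<alpha>)\<close>.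

  The obstacle is that the integral is known only as a limit in probability along some sequence of
  step functions, whose coefficients and partitions are controlled by nothing but convergence in
  L^\<alpha>. No integral against \<open>Z\<close> is constructed. Along one and the same partition,
  the elementary integral of \<open>X\<close> minus \<epsilon> times that of \<open>Z\<close> is a
  Lebesgue integral along a single path, and it converges almost surely to the drift part; the noise
  part is by definition what remains of the integral. Its law is read off from characteristic
  functions alone.

  \<open>J\<close> has just enough derivatives for the Taylor expansion, and in general only inside
  the interval: \<open>ode_solution\<close> is constant for negative times.\<close>

definition stable_exponent :: "real \<Rightarrow> real \<Rightarrow> real \<Rightarrow> complex" where
  "stable_exponent \<alpha> \<kappa> v = complex_of_real (\<bar>v\<bar> powr \<alpha>) * (1 - \<i> * complex_of_real (\<kappa> * sgn v))"

lemma stable_exponent_measurable [measurable]: "stable_exponent \<alpha> \<kappa> \<in> borel_measurable borel"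
  unfolding stable_exponent_def sgn_real_def by measurable

lemma stable_exponent_0 [simp]: "stable_exponent \<alpha> \<kappa> 0 = 0"
  by (simp add: stable_exponent_def)

text \<open>Only nonnegative factors can be pulled out: a negative one flips the skewness term.
  Where \<open>G\<close> is negative, the sign is therefore moved into \<open>v\<close>
  first.\<close>

lemma stable_exponent_mult:
  assumes "0 \<le> r"
  shows "stable_exponent \<alpha> \<kappa> (r * v) = complex_of_real (r powr \<alpha>) * stable_exponent \<alpha> \<kappa> v"
  using assms by (cases "r = 0") (auto simp: stable_exponent_def abs_mult powr_mult sgn_mult)

lemma norm_stable_exponent_le: "cmod (stable_exponent \<alpha> \<kappa> v) \<le> (1 + \<bar>\<kappa>\<bar>) * \<bar>v\<bar> powr \<alpha>"
proof -
  have "cmod (1 - \<i> * complex_of_real (\<kappa> * sgn v)) \<le> 1 + cmod (\<i> * complex_of_real (\<kappa> * sgn v))"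
    using norm_triangle_ineq4[of 1 "\<i> * complex_of_real (\<kappa> * sgn v)"] by simp
  also have "\<dots> \<le> 1 + \<bar>\<kappa>\<bar>"
    by (simp add: norm_mult sgn_real_def abs_mult)
  finally have "cmod (1 - \<i> * complex_of_real (\<kappa> * sgn v)) \<le> 1 + \<bar>\<kappa>\<bar>" .
  then show ?thesis
    unfolding stable_exponent_def norm_mult
    by (metis abs_ge_zero abs_of_nonneg mult.commute mult_right_mono norm_of_real powr_ge_zero)
qed

lemma isCont_stable_exponent:
  assumes "v \<noteq> 0"
  shows "isCont (stable_exponent \<alpha> \<kappa>) v"
  unfolding stable_exponent_def using assms by (intro continuous_intros) auto

text \<open>By homogeneity it is enough to compare \<open>a / \<bar>b\<bar>\<close> with \<open>sgn b\<close>, where the exponent is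
  continuous. This replaces Hoelder's inequality in the passage to the limit in \<open>L\<^sup>\<alpha>\<close>.\<close>

lemma stable_exponent_diff_le:
  assumes \<alpha>: "0 < \<alpha>" and d: "0 < d"
  obtains C where "0 \<le> C"
    "\<And>a b. cmod (stable_exponent \<alpha> \<kappa> a - stable_exponent \<alpha> \<kappa> b) \<le> d * \<bar>b\<bar> powr \<alpha> + C * \<bar>a - b\<bar> powr \<alpha>"
proof -
  let ?\<psi> = "stable_exponent \<alpha> \<kappa>"
  obtain e1 where e1: "0 < e1" "\<And>r. \<bar>r - 1\<bar> < e1 \<Longrightarrow> cmod (?\<psi> r - ?\<psi> 1) < d"
    using isCont_stable_exponent[of 1 \<alpha> \<kappa>] d unfolding isCont_def LIM_def dist_norm
    by (metis real_norm_def norm_zero diff_self zero_neq_one)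
  obtain e2 where e2: "0 < e2" "\<And>r. \<bar>r - (-1)\<bar> < e2 \<Longrightarrow> cmod (?\<psi> r - ?\<psi> (-1)) < d"
    using isCont_stable_exponent[of "-1" \<alpha> \<kappa>] d unfolding isCont_def LIM_def dist_norm
    by (metis real_norm_def norm_zero diff_self neg_equal_0_iff_equal zero_neq_one)
  define e where "e = min e1 e2"
  have e: "0 < e" using e1 e2 by (simp add: e_def)
  \<comment> \<open>Serves the case where \<open>\<bar>a - b\<bar>\<close> is at least
    \<open>e * \<bar>b\<bar>\<close>: then \<open>\<bar>b\<bar>\<close> and
    \<open>\<bar>a\<bar>\<close> are at most \<open>1 / e\<close> and \<open>1 + 1 / e\<close> times
    \<open>\<bar>a - b\<bar>\<close>, and the growth bound applies to each term separately.\<close>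
  define C where "C = (1 + \<bar>\<kappa>\<bar>) * ((1 + 1 / e) powr \<alpha> + (1 / e) powr \<alpha>)"
  have "cmod (?\<psi> a - ?\<psi> b) \<le> d * \<bar>b\<bar> powr \<alpha> + C * \<bar>a - b\<bar> powr \<alpha>" for a b
  proof (cases "\<bar>a - b\<bar> < e * \<bar>b\<bar>")
    case True
    then have b: "b \<noteq> 0" by auto
    have "\<bar>a / \<bar>b\<bar> - sgn b\<bar> = \<bar>a - b\<bar> / \<bar>b\<bar>"
      using b by (auto simp: sgn_real_def abs_if divide_simps)
    also have "\<dots> < e" using True b by (simp add: divide_simps)
    finally have close: "\<bar>a / \<bar>b\<bar> - sgn b\<bar> < e" .
    have "cmod (?\<psi> (a / \<bar>b\<bar>) - ?\<psi> (sgn b)) < d"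
      using close e1(2)[of "a / \<bar>b\<bar>"] e2(2)[of "a / \<bar>b\<bar>"] b by (auto simp: e_def sgn_real_def split: if_splits)
    moreover have "?\<psi> a - ?\<psi> b = complex_of_real (\<bar>b\<bar> powr \<alpha>) * (?\<psi> (a / \<bar>b\<bar>) - ?\<psi> (sgn b))"
      using stable_exponent_mult[of "\<bar>b\<bar>" \<alpha> \<kappa> "a / \<bar>b\<bar>"] stable_exponent_mult[of "\<bar>b\<bar>" \<alpha> \<kappa> "sgn b"] b
      by (simp add: right_diff_distrib abs_mult_sgn)
    ultimately have "cmod (?\<psi> a - ?\<psi> b) \<le> \<bar>b\<bar> powr \<alpha> * d"
      by (simp add: norm_mult mult_left_mono)
    moreover have "0 \<le> C * \<bar>a - b\<bar> powr \<alpha>" by (simp add: C_def)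
    ultimately show ?thesis by (simp add: mult.commute)
  next
    case False
    then have b: "\<bar>b\<bar> \<le> (1 / e) * \<bar>a - b\<bar>" using e by (simp add: field_simps)
    then have a: "\<bar>a\<bar> \<le> (1 + 1 / e) * \<bar>a - b\<bar>" by (simp add: distrib_right)
    have "\<bar>a\<bar> powr \<alpha> \<le> (1 + 1 / e) powr \<alpha> * \<bar>a - b\<bar> powr \<alpha>"
      using powr_mono2[OF _ _ a, of \<alpha>] \<alpha> e by (simp add: powr_mult)
    moreover have "\<bar>b\<bar> powr \<alpha> \<le> (1 / e) powr \<alpha> * \<bar>a - b\<bar> powr \<alpha>"
      using powr_mono2[OF _ _ b, of \<alpha>] \<alpha> e by (simp add: powr_mult powr_divide)
    ultimately have "(1 + \<bar>\<kappa>\<bar>) * (\<bar>a\<bar> powr \<alpha> + \<bar>b\<bar> powr \<alpha>) \<le> C * \<bar>a - b\<bar> powr \<alpha>"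
      unfolding C_def mult.assoc by (intro mult_left_mono) (auto simp: distrib_right)
    moreover have "cmod (?\<psi> a - ?\<psi> b) \<le> (1 + \<bar>\<kappa>\<bar>) * (\<bar>a\<bar> powr \<alpha> + \<bar>b\<bar> powr \<alpha>)"
      using norm_triangle_ineq4[of "?\<psi> a" "?\<psi> b"] norm_stable_exponent_le[of \<alpha> \<kappa> a]
        norm_stable_exponent_le[of \<alpha> \<kappa> b] by (simp add: distrib_left)
    moreover have "0 \<le> d * \<bar>b\<bar> powr \<alpha>" using d by simp
    ultimately show ?thesis by linarith
  qed
  moreover have "0 \<le> C" by (simp add: C_def)
  ultimately show ?thesis using that by blast
qed

section \<open>Cadlag paths and Gronwall's inequality\<close>

lemma cadlag_on_subset: "cadlag_on I f \<Longrightarrow> I' \<subseteq> I \<Longrightarrow> cadlag_on I' f"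
  unfolding cadlag_on_def
  by (meson Int_mono order_refl subsetD tendsto_within_subset)

text \<open>Near each point the values stay within 1 of the value there or of the left limit, so the
  function is locally bounded; compactness makes this global. The sum over the finite subcover
  serves as a bound even when the interval, and with it the cover, is empty.\<close>

lemma cadlag_on_bounded:
  assumes f: "cadlag_on {a..b} f"
  obtains S where "0 \<le> S" "\<And>s. s \<in> {a..b} \<Longrightarrow> \<bar>f s\<bar> \<le> S"
proof -
  have "\<exists>U K. open U \<and> s \<in> U \<and> (\<forall>r\<in>U \<inter> {a..b}. \<bar>f r\<bar> \<le> K)" if s: "s \<in> {a..b}" for s
  proof -
    obtain l where r: "(f \<longlongrightarrow> f s) (at s within ({a..b} \<inter> {s<..}))"
      and l: "(f \<longlongrightarrow> l) (at s within ({a..b} \<inter> {..<s}))"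
      using f s unfolding cadlag_on_def by blast
    obtain U1 where U1: "open U1" "s \<in> U1" "\<And>r. r \<in> U1 \<Longrightarrow> r \<in> {a..b} \<inter> {s<..} \<Longrightarrow> dist (f r) (f s) < 1"
      using tendstoD[OF r, of 1] unfolding eventually_at_topological by fastforce
    obtain U2 where U2: "open U2" "s \<in> U2" "\<And>r. r \<in> U2 \<Longrightarrow> r \<in> {a..b} \<inter> {..<s} \<Longrightarrow> dist (f r) l < 1"
      using tendstoD[OF l, of 1] unfolding eventually_at_topological by fastforce
    have "\<bar>f r\<bar> \<le> \<bar>f s\<bar> + \<bar>l\<bar> + 1" if "r \<in> U1 \<inter> U2 \<inter> {a..b}" for r
      using that U1(3)[of r] U2(3)[of r] by (cases r s rule: linorder_cases) (auto simp: dist_real_def)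
    then show ?thesis using U1 U2 by (intro exI[of _ "U1 \<inter> U2"] exI[of _ "\<bar>f s\<bar> + \<bar>l\<bar> + 1"]) auto
  qed
  then obtain U K where UK: "\<And>s. s \<in> {a..b} \<Longrightarrow> open (U s) \<and> s \<in> U s \<and> (\<forall>r\<in>U s \<inter> {a..b}. \<bar>f r\<bar> \<le> K s)"
    by metis
  obtain C where C: "C \<subseteq> {a..b}" "finite C" "{a..b} \<subseteq> (\<Union>c\<in>C. U c)"
    by (rule compactE_image[of "{a..b}" "{a..b}" U]) (use UK in auto)
  have "\<bar>f s\<bar> \<le> (\<Sum>c\<in>C. \<bar>K c\<bar>)" if s: "s \<in> {a..b}" for s
  proof -
    obtain c where c: "c \<in> C" "s \<in> U c" using C s by auto
    then have "\<bar>f s\<bar> \<le> K c" using UK[of c] C s by blast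
    also have "\<dots> \<le> \<bar>K c\<bar>" by simp
    also have "\<dots> \<le> (\<Sum>c\<in>C. \<bar>K c\<bar>)" using c C by (intro member_le_sum) auto
    finally show ?thesis .
  qed
  then show ?thesis by (intro that[of "\<Sum>c\<in>C. \<bar>K c\<bar>"]) (auto intro: sum_nonneg)
qed

text \<open>A right-continuous function is the pointwise limit of its right-endpoint discretisations.\<close>

lemma cadlag_on_measurable:
  assumes f: "cadlag_on {a..b} f"
  shows "(\<lambda>s. indicator {a..b} s * f s) \<in> borel_measurable borel"
proof -
  \<comment> \<open>The argument of \<open>f\<close> is the next grid point strictly to the right of
    \<open>s\<close>, cut off at \<open>b\<close> to stay in the interval. It depends on
    \<open>s\<close> only through an integer, so measurability holds whatever \<open>f\<close>
    is.\<close>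
  define g where "g n s = indicator {a..b} s * f (min b ((of_int \<lfloor>real (Suc n) * s\<rfloor> + 1) / real (Suc n)))" for n s
  have [measurable]: "g n \<in> borel_measurable borel" for n
  proof -
    have "(\<lambda>s. (\<lambda>z::int. f (min b ((of_int z + 1) / real (Suc n)))) \<lfloor>real (Suc n) * s\<rfloor>) \<in> borel_measurable borel"
      by (rule measurable_compose[where N = "count_space UNIV"]) measurable
    then show ?thesis unfolding g_def by measurable
  qed
  have "(\<lambda>n. g n s) \<longlonglongrightarrow> indicator {a..b} s * f s" for s
  proof (cases "s \<in> {a..b}")
    case True
    define q where "q n = min b ((of_int \<lfloor>real (Suc n) * s\<rfloor> + 1) / real (Suc n))" for n
    have q1: "s < (of_int \<lfloor>real (Suc n) * s\<rfloor> + 1) / real (Suc n)" for n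
      using floor_correct[of "real (Suc n) * s"] by (simp add: pos_less_divide_eq mult.commute del: of_nat_Suc)
    have q2: "(of_int \<lfloor>real (Suc n) * s\<rfloor> + 1) / real (Suc n) \<le> s + 1 / real (Suc n)" for n
      proof -
      have "of_int \<lfloor>real (Suc n) * s\<rfloor> + 1 \<le> (s + 1 / real (Suc n)) * real (Suc n)"
        unfolding distrib_right by (simp add: mult.commute[of s] del: of_nat_Suc)
      then show ?thesis by (subst pos_divide_le_eq) auto
    qed
    have qs: "q \<longlonglongrightarrow> s"
    proof (rule tendsto_sandwich[of "\<lambda>_. s" _ _ "\<lambda>n. s + 1 / real (Suc n)"])
      show "(\<lambda>n. s + 1 / real (Suc n)) \<longlonglongrightarrow> s"
        using tendsto_add[OF tendsto_const LIMSEQ_inverse_real_of_nat, of s] by (simp add: inverse_eq_divide)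
      show "\<forall>\<^sub>F n in sequentially. s \<le> q n" using True q1 by (auto simp: q_def less_imp_le)
      show "\<forall>\<^sub>F n in sequentially. q n \<le> s + 1 / real (Suc n)" using q2 by (auto simp: q_def min_le_iff_disj)
    qed simp
    \<comment> \<open>At \<open>s = b\<close> the cut-off makes \<open>q\<close> constant. Elsewhere
      \<open>q n\<close> lies strictly to the right of \<open>s\<close>, as the punctured right-hand
      filter demands.\<close>
    have "(\<lambda>n. f (q n)) \<longlonglongrightarrow> f s"
    proof (cases "s = b")
      case True
      then have "q n = s" for n using q1[of n] by (simp add: q_def)
      then show ?thesis by simp
    next
      case False
      then have "s < q n" "q n \<in> {a..b}" for n using q1[of n] \<open>s \<in> {a..b}\<close> by (auto simp: q_def)
      moreover have "(f \<longlongrightarrow> f s) (at s within ({a..b} \<inter> {s<..}))"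
        using f \<open>s \<in> {a..b}\<close> unfolding cadlag_on_def by blast
      ultimately show ?thesis using qs
        unfolding tendsto_at_iff_sequentially comp_def by (auto simp: less_imp_neq[symmetric])
    qed
    then show ?thesis using True by (simp add: g_def q_def)
  qed (simp add: g_def)
  then show ?thesis by (rule borel_measurable_LIMSEQ_real) measurable
qed

text \<open>Gronwall's inequality, via the supremum \<open>Q\<close> of \<open>\<bar>d\<bar>\<close> weighted by \<open>exp (- 2 L s)\<close>: the hypothesis
  gives \<open>Q \<le> K + Q / 2\<close>.\<close>

lemma gronwall_bounded:
  fixes d \<theta> :: "real \<Rightarrow> real"
  assumes L: "0 < L" and K: "0 \<le> K"
    and \<theta>: "\<And>s. s \<in> {0..T} \<Longrightarrow> \<bar>\<theta> s\<bar> \<le> L"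
    and bound: "\<And>s. s \<in> {0..T} \<Longrightarrow> \<bar>d s\<bar> \<le> B"
    and d: "\<And>s. s \<in> {0..T} \<Longrightarrow> \<bar>d s\<bar> \<le> \<bar>LINT r:{0..s}|lborel. \<theta> r * d r\<bar> + K"
    and s: "s \<in> {0..T}"
  shows "\<bar>d s\<bar> \<le> 2 * K * exp (2 * L * T)"
proof -
  define w where "w s = exp (- 2 * L * s) * \<bar>d s\<bar>" for s
  define Q where "Q = (SUP s\<in>{0..T}. w s)"
  have bdd: "bdd_above (w ` {0..T})"
  proof (rule bdd_aboveI2[of _ _ "B"])
    fix s assume s: "s \<in> {0..T}"
    then show "w s \<le> B" using L bound[OF s] mult_mono[of "exp (- 2 * L * s)" 1 "\<bar>d s\<bar>" B]
      unfolding w_def by auto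
  qed
  have wQ: "w s \<le> Q" if "s \<in> {0..T}" for s
    unfolding Q_def by (rule cSUP_upper[OF that bdd])
  have Q0: "0 \<le> Q" using wQ[OF s] unfolding w_def by (smt (verit) exp_ge_zero abs_ge_zero mult_nonneg_nonneg)
  have dQ: "\<bar>d r\<bar> \<le> Q * exp (2 * L * r)" if "r \<in> {0..T}" for r
    using wQ[OF that] by (simp add: w_def exp_minus field_simps)
  have half: "w r \<le> K + Q / 2" if r: "r \<in> {0..T}" for r
  proof -
    \<comment> \<open>The rate of the weight is twice \<open>L\<close>, so integrating
      \<open>L * Q * exp (2 * L * x)\<close> leaves the factor 1/2 that allows \<open>Q\<close> to
      be absorbed.\<close>
    have der: "((\<lambda>x. Q / 2 * exp (2 * L * x)) has_vector_derivative L * Q * exp (2 * L * x)) (at x within A)" for x A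
      unfolding has_real_derivative_iff_has_vector_derivative[symmetric]
      by (auto intro!: derivative_eq_intros)
    have hi: "has_bochner_integral lborel (\<lambda>x. indicator {0..r} x *\<^sub>R (L * Q * exp (2 * L * x)))
        (Q / 2 * exp (2 * L * r) - Q / 2 * exp (2 * L * 0))"
      using r by (intro has_bochner_integral_FTC_Icc der) (auto intro!: continuous_intros)
    have "\<bar>LINT x:{0..r}|lborel. \<theta> x * d x\<bar> \<le> (LINT x:{0..r}|lborel. \<bar>\<theta> x * d x\<bar>)"
      unfolding set_lebesgue_integral_def
      using integral_norm_bound[of lborel "\<lambda>x. indicator {0..r} x *\<^sub>R (\<theta> x * d x)"] by (simp add: abs_mult)
    \<comment> \<open>The majorant alone has to be integrable: a Bochner integral that does not
      exist is 0, which lies below the integral of a nonnegative function.\<close>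
    also have "\<dots> \<le> (LINT x:{0..r}|lborel. L * Q * exp (2 * L * x))"
      unfolding set_lebesgue_integral_def
    proof (rule integral_mono')
      show "integrable lborel (\<lambda>x. indicator {0..r} x *\<^sub>R (L * Q * exp (2 * L * x)))"
        using hi by (simp add: integrable.intros)
      fix x
      show "indicator {0..r} x *\<^sub>R \<bar>\<theta> x * d x\<bar> \<le> indicator {0..r} x *\<^sub>R (L * Q * exp (2 * L * x))"
        using \<theta>[of x] dQ[of x] r mult_mono[of "\<bar>\<theta> x\<bar>" L "\<bar>d x\<bar>" "Q * exp (2 * L * x)"] L
        by (auto simp: indicator_def abs_mult)
    qed (use L Q0 in \<open>auto simp: indicator_def\<close>)
    also have "\<dots> = Q / 2 * exp (2 * L * r) - Q / 2"
      unfolding set_lebesgue_integral_def using has_bochner_integral_integral_eq[OF hi] by (simp only: mult_zero_right exp_zero mult_1_right)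
    also have "\<dots> \<le> Q / 2 * exp (2 * L * r)" using Q0 by simp
    finally have "\<bar>d r\<bar> \<le> Q / 2 * exp (2 * L * r) + K" using d[OF r] by linarith
    moreover have "K \<le> K * exp (2 * L * r)"
      using K L r by (simp add: mult_le_cancel_left1)
    ultimately have "\<bar>d r\<bar> \<le> (K + Q / 2) * exp (2 * L * r)" by (simp add: algebra_simps)
    then show ?thesis by (simp add: w_def exp_minus field_simps)
  qed
  have "Q \<le> K + Q / 2" unfolding Q_def[symmetric]
    using half s by (subst Q_def) (intro cSUP_least, auto)
  then have "Q \<le> 2 * K" by simp
  then have "\<bar>d s\<bar> \<le> 2 * K * exp (2 * L * s)" using dQ[OF s] by (smt (verit) exp_ge_zero mult_right_mono)
  also have "\<dots> \<le> 2 * K * exp (2 * L * T)" using s L K by (intro mult_left_mono) auto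
  finally show ?thesis .
qed

section \<open>Higher derivatives and the bias of a kernel\<close>

text \<open>Derivatives are existential witnesses instead of \<open>deriv\<close>, so that the sum
  and product rules become plain inductions on the order. They are two-sided at every point of
  \<open>S\<close>, and the set is taken open wherever the witnesses are exchanged for
  \<open>deriv\<close>.\<close>

primrec continuously_differentiable :: "nat \<Rightarrow> (real \<Rightarrow> real) \<Rightarrow> real set \<Rightarrow> bool" where
  "continuously_differentiable 0 f S \<longleftrightarrow> continuous_on S f"
| "continuously_differentiable (Suc k) f S \<longleftrightarrow>
     (\<exists>f'. (\<forall>x\<in>S. (f has_real_derivative f' x) (at x)) \<and> continuously_differentiable k f' S)"

lemma continuously_differentiable_SucD:
  "continuously_differentiable (Suc k) f S \<Longrightarrow> continuously_differentiable k f S"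
proof (induction k arbitrary: f)
  case 0
  then show ?case by (auto intro: DERIV_continuous_on has_field_derivative_at_within)
next
  case (Suc k)
  then show ?case using continuously_differentiable.simps(2) by meson
qed

lemma continuously_differentiable_add:
  "continuously_differentiable k f S \<Longrightarrow> continuously_differentiable k g S \<Longrightarrow>
    continuously_differentiable k (\<lambda>x. f x + g x) S"
proof (induction k arbitrary: f g)
  case 0
  then show ?case by (auto intro: continuous_on_add)
next
  case (Suc k)
  then obtain f' g' where "\<forall>x\<in>S. (f has_real_derivative f' x) (at x)" "continuously_differentiable k f' S"
    "\<forall>x\<in>S. (g has_real_derivative g' x) (at x)" "continuously_differentiable k g' S" by auto
  then show ?case using Suc.IH by (auto intro!: exI[of _ "\<lambda>x. f' x + g' x"] derivative_eq_intros)
qed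

lemma continuously_differentiable_mult:
  "continuously_differentiable k f S \<Longrightarrow> continuously_differentiable k g S \<Longrightarrow>
    continuously_differentiable k (\<lambda>x. f x * g x) S"
proof (induction k arbitrary: f g)
  case 0
  then show ?case by (auto intro: continuous_on_mult)
next
  case (Suc k)
  then obtain f' g' where *: "\<forall>x\<in>S. (f has_real_derivative f' x) (at x)" "continuously_differentiable k f' S"
    "\<forall>x\<in>S. (g has_real_derivative g' x) (at x)" "continuously_differentiable k g' S" by auto
  have "continuously_differentiable k f S" "continuously_differentiable k g S"
    by (rule continuously_differentiable_SucD, rule Suc.prems)+
  then have "continuously_differentiable k (\<lambda>x. f' x * g x + g' x * f x) S"
    using * by (intro continuously_differentiable_add Suc.IH) auto
  then show ?case using * by (auto intro!: exI[of _ "\<lambda>x. f' x * g x + g' x * f x"] derivative_eq_intros)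
qed

lemma continuously_differentiable_cong:
  assumes "continuously_differentiable k f S" "open S" "\<And>x. x \<in> S \<Longrightarrow> f x = g x"
  shows "continuously_differentiable k g S"
proof (cases k)
  case 0
  then show ?thesis using assms continuous_on_cong[OF refl, of S f g] by auto
next
  case (Suc j)
  then obtain f' where f': "\<forall>x\<in>S. (f has_real_derivative f' x) (at x)" "continuously_differentiable j f' S"
    using assms by auto
  then have "\<forall>x\<in>S. (g has_real_derivative f' x) (at x)"
    using assms has_field_derivative_transform_within_open[of f _ _ S g] by blast
  then show ?thesis using f' Suc by auto
qed

lemma continuously_differentiable_deriv:
  assumes "continuously_differentiable (Suc k) f S" "open S"
  shows "continuously_differentiable k (deriv f) S" "\<And>x. x \<in> S \<Longrightarrow> (f has_real_derivative deriv f x) (at x)"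
proof -
  obtain f' where f': "\<forall>x\<in>S. (f has_real_derivative f' x) (at x)" "continuously_differentiable k f' S"
    using assms by auto
  then have "deriv f x = f' x" if "x \<in> S" for x using DERIV_imp_deriv that by blast
  then show "continuously_differentiable k (deriv f) S" "\<And>x. x \<in> S \<Longrightarrow> (f has_real_derivative deriv f x) (at x)"
    using f' continuously_differentiable_cong[OF f'(2) assms(2)] by auto
qed

text \<open>Leads back from witnesses to the iterated \<open>deriv\<close> in which the limit
  constant is expressed. On an open set, agreement of functions passes to their derivatives, so each
  witness may be replaced by \<open>deriv\<close> level by level.\<close>

lemma continuously_differentiable_higher_deriv:
  assumes "continuously_differentiable k f S" "open S"
  shows "continuous_on S ((deriv ^^ k) f)"
    "\<And>i x. i < k \<Longrightarrow> x \<in> S \<Longrightarrow> ((deriv ^^ i) f has_real_derivative (deriv ^^ Suc i) f x) (at x)"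
proof -
  have "continuous_on S ((deriv ^^ k) f) \<and>
    (\<forall>i<k. \<forall>x\<in>S. ((deriv ^^ i) f has_real_derivative (deriv ^^ Suc i) f x) (at x))"
    using assms(1)
  proof (induction k arbitrary: f)
    case (Suc k)
    note IH = Suc.IH[OF continuously_differentiable_deriv(1)[OF Suc.prems assms(2)]]
    have "((deriv ^^ i) f has_real_derivative (deriv ^^ Suc i) f x) (at x)" if "i < Suc k" "x \<in> S" for i x
      using IH that continuously_differentiable_deriv(2)[OF Suc.prems assms(2) that(2)]
      by (cases i) (auto simp: funpow_swap1)
    then show ?case using IH by (auto simp: funpow_swap1)
  qed auto
  then show "continuous_on S ((deriv ^^ k) f)"
    "\<And>i x. i < k \<Longrightarrow> x \<in> S \<Longrightarrow> ((deriv ^^ i) f has_real_derivative (deriv ^^ Suc i) f x) (at x)" by auto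
qed

lemma continuously_differentiable_higher_derivI:
  assumes "\<And>i x. i < k \<Longrightarrow> (deriv ^^ i) f field_differentiable at x" "continuous_on UNIV ((deriv ^^ k) f)"
  shows "continuously_differentiable k f S"
  using assms
proof (induction k arbitrary: f)
  case 0
  then show ?case by (auto intro: continuous_on_subset)
next
  case (Suc k)
  have "continuously_differentiable k (deriv f) S"
    using Suc.prems(1)[of "Suc _"] Suc.prems(2) by (intro Suc.IH) (auto simp: funpow_swap1)
  moreover have "(f has_real_derivative deriv f x) (at x)" for x
    using Suc.prems(1)[of 0 x] by (simp add: DERIV_deriv_iff_field_differentiable)
  ultimately show ?case by auto
qed

lemma Theta_class_continuously_differentiable:
  assumes "\<theta> \<in> Theta_class T L L' j"
  shows "continuously_differentiable j \<theta> S"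
proof (rule continuously_differentiable_higher_derivI)
  show "(deriv ^^ i) \<theta> field_differentiable at x" if "i < j" for i x
    using assms that by (auto simp: Theta_class_def)
  have "\<bar>(deriv ^^ j) \<theta> x - (deriv ^^ j) \<theta> y\<bar> \<le> L' * \<bar>x - y\<bar>" for x y
    using assms by (auto simp: Theta_class_def)
  \<comment> \<open>\<open>lipschitz_on\<close> asks for a nonnegative constant, hence the absolute
    value.\<close>
  then have "\<bar>L'\<bar>-lipschitz_on UNIV ((deriv ^^ j) \<theta>)"
    by (intro lipschitz_onI) (auto simp: dist_real_def intro: order_trans[OF _ mult_right_mono[OF abs_ge_self]])
  then show "continuous_on UNIV ((deriv ^^ j) \<theta>)" by (rule lipschitz_on_continuous_on)
qed

section \<open>Taylor expansion under a kernel with vanishing moments\<close>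

lemma integrable_kernel_mult:
  fixes G g :: "real \<Rightarrow> real"
  assumes G [measurable]: "G \<in> borel_measurable borel" and K: "\<And>u. \<bar>G u\<bar> \<le> K"
    and supp: "\<And>u. u \<notin> {A..B} \<Longrightarrow> G u = 0" and g: "set_integrable lborel {A..B} g"
  shows "integrable lborel (\<lambda>u. G u * g u)"
proof -
  have g': "integrable lborel (\<lambda>u. indicator {A..B} u * g u)"
    using g by (simp add: set_integrable_def)
  then have [measurable]: "(\<lambda>u. indicator {A..B} u * g u) \<in> borel_measurable borel" by auto
  \<comment> \<open>\<open>g\<close> is controlled on the support interval only; the indicator
    restores global measurability and does not change the product.\<close>
  have eq: "(\<lambda>u. G u * g u) = (\<lambda>u. G u * (indicator {A..B} u * g u))"
    using supp by (intro ext) (metis indicator_eq_1_iff mult_1 mult_zero_left)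
  show ?thesis unfolding eq
  proof (rule Bochner_Integration.integrable_bound)
    show "integrable lborel (\<lambda>u. K * (indicator {A..B} u * g u))" using g' by simp
    show "AE u in lborel. norm (G u * (indicator {A..B} u * g u)) \<le> norm (K * (indicator {A..B} u * g u))"
      using K by (auto simp: abs_mult intro!: mult_right_mono order_trans[OF K abs_ge_self])
  qed measurable
qed

text \<open>The top derivative is merely continuous at \<open>t\<close>, which suffices for the
  Peano form of Taylor's theorem: the remainder of order \<open>k + 1\<close> is small relative to
  \<open>h ^ Suc k\<close>, uniformly over the compact support of \<open>G\<close>.\<close>

lemma kernel_bias:
  fixes G J :: "real \<Rightarrow> real"
  assumes G [measurable]: "G \<in> borel_measurable borel" and K: "\<And>u. \<bar>G u\<bar> \<le> K"
    and supp: "\<And>u. u \<notin> {A..B} \<Longrightarrow> G u = 0"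
    and int1: "(LINT u|lborel. G u) = 1"
    and int0: "\<And>j. j \<in> {1..k} \<Longrightarrow> (LINT u|lborel. u ^ j * G u) = 0"
    and J: "continuously_differentiable (Suc k) J S" and S: "open S" "t \<in> S"
  shows "((\<lambda>h. ((LINT u|lborel. G u * J (t + h * u)) - J t) / h ^ Suc k) \<longlongrightarrow>
            (deriv ^^ Suc k) J t / fact (Suc k) * (LINT u|lborel. G u * u ^ Suc k)) (at_right 0)"
proof (rule tendstoI)
  let ?m = "(deriv ^^ Suc k) J t / fact (Suc k) * (LINT u|lborel. G u * u ^ Suc k)"
  fix e0 :: real assume e0: "0 < e0"
  note intG = integrable_kernel_mult[OF G K supp]
  have pow: "integrable lborel (\<lambda>u. G u * u ^ j)" for j
    by (rule intG) (auto intro!: borel_integrable_atLeastAtMost' continuous_intros)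
  define C where "C = (LINT u|lborel. \<bar>G u * u ^ Suc k\<bar>)"
  have C: "0 \<le> C" by (simp add: C_def)
  \<comment> \<open>The final error is \<open>e * C\<close>, which has to stay below
    \<open>e0\<close>; the added 1 covers \<open>C = 0\<close>.\<close>
  define e where "e = e0 / (C + 1)"
  have e: "0 < e" using e0 C by (simp add: e_def)
  have "isCont ((deriv ^^ Suc k) J) t"
    using continuously_differentiable_higher_deriv(1)[OF J S(1)] S continuous_on_eq_continuous_at by blast
  then obtain d1 where d1: "0 < d1" "\<And>y. \<bar>y - t\<bar> < d1 \<Longrightarrow> \<bar>(deriv ^^ Suc k) J y - (deriv ^^ Suc k) J t\<bar> < e"
    unfolding continuous_at_eps_delta real_norm_def dist_real_def using e by (metis)
  obtain d2 where d2: "0 < d2" "ball t d2 \<subseteq> S" using S openE by blast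
  define d where "d = min d1 d2"
  have d: "0 < d" using d1 d2 by (simp add: d_def)
  define R where "R = \<bar>A\<bar> + \<bar>B\<bar> + 1"
  have R: "0 < R" by (simp add: R_def)
  have main: "dist (((LINT u|lborel. G u * J (t + h * u)) - J t) / h ^ Suc k) ?m < e0"
    if h: "0 < h" "h < d / R" for h
  proof -
    have hR: "h * R < d" using h R by (simp add: field_simps)
    have near: "\<bar>h * u\<bar> < d" if "u \<in> {A..B}" for u
    proof -
      have "\<bar>u\<bar> \<le> R" using that by (auto simp: R_def)
      then have "\<bar>h * u\<bar> \<le> h * R" using h by (simp add: abs_mult mult_left_mono)
      then show ?thesis using hR by simp
    qed
    \<comment> \<open>The polynomial includes the term of order \<open>k + 1\<close>. The difference
      to the Lagrange form is then governed by the change of the top derivative between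
      \<open>t\<close> and the intermediate point, which continuity makes small.\<close>
    define P where "P u = (\<Sum>j<Suc (Suc k). (deriv ^^ j) J t / fact j * (h * u) ^ j)" for u
    have taylor: "\<bar>J (t + h * u) - P u\<bar> \<le> e * h ^ Suc k * \<bar>u ^ Suc k\<bar>" if u: "u \<in> {A..B}" for u
    proof (cases "u = 0")
      case True
      then show ?thesis by (simp add: P_def sum.lessThan_Suc_shift del: sum.lessThan_Suc)
    next
      case False
      have "\<exists>\<xi>. (if t + h * u < t then t + h * u < \<xi> \<and> \<xi> < t else t < \<xi> \<and> \<xi> < t + h * u) \<and>
          J (t + h * u) = (\<Sum>j<Suc k. (deriv ^^ j) J t / fact j * (t + h * u - t) ^ j)
            + (deriv ^^ Suc k) J \<xi> / fact (Suc k) * (t + h * u - t) ^ Suc k"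
      proof (rule Taylor[where a = "t - \<bar>h * u\<bar>" and b = "t + \<bar>h * u\<bar>"])
        show "\<forall>m s. m < Suc k \<and> t - \<bar>h * u\<bar> \<le> s \<and> s \<le> t + \<bar>h * u\<bar> \<longrightarrow>
            ((deriv ^^ m) J has_real_derivative (deriv ^^ Suc m) J s) (at s)"
          using near[OF u] d2 by (intro allI impI continuously_differentiable_higher_deriv(2)[OF J S(1)])
            (auto simp: d_def dist_real_def subset_iff)
      qed (use False h in auto)
      then obtain \<xi> where \<xi>: "if h * u < 0 then t + h * u < \<xi> \<and> \<xi> < t else t < \<xi> \<and> \<xi> < t + h * u"
        and eq: "J (t + h * u) = (\<Sum>j<Suc k. (deriv ^^ j) J t / fact j * (h * u) ^ j)
            + (deriv ^^ Suc k) J \<xi> / fact (Suc k) * (h * u) ^ Suc k" by auto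
      have "\<bar>\<xi> - t\<bar> < d1" using \<xi> near[OF u] by (auto simp: d_def split: if_splits)
      from d1(2)[OF this] have le: "\<bar>(deriv ^^ Suc k) J \<xi> - (deriv ^^ Suc k) J t\<bar> / fact (Suc k) \<le> e"
        using fact_ge_1[of "Suc k", where 'a = real] e
        by (smt (verit) divide_le_eq_1_pos divide_right_mono frac_le fact_gt_zero div_by_1 abs_ge_zero)
      have "J (t + h * u) - P u = ((deriv ^^ Suc k) J \<xi> - (deriv ^^ Suc k) J t) / fact (Suc k) * (h * u) ^ Suc k"
        unfolding P_def eq sum.lessThan_Suc[of _ "Suc k"] by (simp only: diff_divide_distrib left_diff_distrib)
      then have "\<bar>J (t + h * u) - P u\<bar> = \<bar>(deriv ^^ Suc k) J \<xi> - (deriv ^^ Suc k) J t\<bar> / fact (Suc k) * \<bar>(h * u) ^ Suc k\<bar>"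
        by (simp only: abs_mult abs_divide abs_of_nonneg[OF fact_ge_zero])
      also have "\<dots> \<le> e * \<bar>(h * u) ^ Suc k\<bar>" by (intro mult_right_mono le) simp
      also have "\<dots> = e * h ^ Suc k * \<bar>u ^ Suc k\<bar>"
        using h unfolding power_mult_distrib abs_mult by (simp add: abs_mult)
      finally show ?thesis .
    qed
    have contJ: "continuous_on {A..B} (\<lambda>u. J (t + h * u))"
    proof (rule continuous_on_compose2[of S J])
      have "(J has_real_derivative deriv J x) (at x)" if "x \<in> S" for x
        using continuously_differentiable_deriv(2)[OF J S(1) that] .
      then show "continuous_on S J" by (meson DERIV_continuous_on has_field_derivative_at_within)
      show "(\<lambda>u. t + h * u) ` {A..B} \<subseteq> S"
        using near d2(2) by (auto simp: d_def dist_real_def subset_iff)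
    qed (intro continuous_intros)
    have intJ: "integrable lborel (\<lambda>u. G u * J (t + h * u))"
      by (rule intG) (auto intro!: borel_integrable_atLeastAtMost' contJ)
    have GP: "G u * P u = (\<Sum>j<Suc (Suc k). ((deriv ^^ j) J t / fact j * h ^ j) * (G u * u ^ j))" for u
      unfolding P_def sum_distrib_left by (intro sum.cong) (auto simp: power_mult_distrib)
    have intP: "integrable lborel (\<lambda>u. G u * P u)" unfolding GP by (intro Bochner_Integration.integrable_sum integrable_mult_right pow)
    have "(LINT u|lborel. G u * P u) = (\<Sum>j<Suc (Suc k). ((deriv ^^ j) J t / fact j * h ^ j) * (LINT u|lborel. G u * u ^ j))"
      unfolding GP by (subst Bochner_Integration.integral_sum) (auto intro!: pow)
    \<comment> \<open>Total mass 1 produces the term of order 0, the moment conditions remove the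
      orders 1 to \<open>k\<close>, and the order \<open>k + 1\<close> carries the limit.\<close>
    also have "\<dots> = (\<Sum>j<Suc k. if j = 0 then J t else 0) + h ^ Suc k * ?m"
      unfolding sum.lessThan_Suc[of _ "Suc k"]
    proof (intro arg_cong2[where f = "(+)"] sum.cong refl)
      fix j assume "j \<in> {..<Suc k}"
      then show "((deriv ^^ j) J t / fact j * h ^ j) * (LINT u|lborel. G u * u ^ j) = (if j = 0 then J t else 0)"
        using int0[of j] int1 by (auto simp: mult.commute)
    qed (simp add: mult_ac)
    also have "(\<Sum>j<Suc k. if j = 0 then J t else 0) = J t" by simp
    finally have intGP: "(LINT u|lborel. G u * P u) = J t + h ^ Suc k * ?m" .
    have "\<bar>(LINT u|lborel. G u * J (t + h * u)) - (J t + h ^ Suc k * ?m)\<bar>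
        = \<bar>LINT u|lborel. G u * J (t + h * u) - G u * P u\<bar>"
      unfolding intGP[symmetric] using intJ intP by simp
    also have "\<dots> \<le> (LINT u|lborel. \<bar>G u * J (t + h * u) - G u * P u\<bar>)" by (rule integral_abs_bound)
    also have "\<dots> \<le> (LINT u|lborel. e * h ^ Suc k * \<bar>G u * u ^ Suc k\<bar>)"
    proof (rule integral_mono')
      show "integrable lborel (\<lambda>u. e * h ^ Suc k * \<bar>G u * u ^ Suc k\<bar>)"
        using pow[of "Suc k"] by (intro integrable_mult_right integrable_abs)
      fix u
      show "\<bar>G u * J (t + h * u) - G u * P u\<bar> \<le> e * h ^ Suc k * \<bar>G u * u ^ Suc k\<bar>"
      proof (cases "u \<in> {A..B}")
        case True
        have "\<bar>G u\<bar> * \<bar>J (t + h * u) - P u\<bar> \<le> \<bar>G u\<bar> * (e * h ^ Suc k * \<bar>u ^ Suc k\<bar>)"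
          by (intro mult_left_mono taylor True) simp
        then show ?thesis by (simp only: right_diff_distrib[symmetric] abs_mult mult_ac)
      next
        case False
        then show ?thesis using supp by simp
      qed
      show "0 \<le> e * h ^ Suc k * \<bar>G u * u ^ Suc k\<bar>" using e h by simp
    qed
    also have "\<dots> = e * C * h ^ Suc k" by (simp add: C_def)
    finally have le: "\<bar>(LINT u|lborel. G u * J (t + h * u)) - (J t + h ^ Suc k * ?m)\<bar> \<le> e * C * h ^ Suc k" .
    have hk: "0 < h ^ Suc k" using h by simp
    have "((LINT u|lborel. G u * J (t + h * u)) - J t) / h ^ Suc k - ?m
        = ((LINT u|lborel. G u * J (t + h * u)) - (J t + h ^ Suc k * ?m)) / h ^ Suc k"
      using h by (simp only: diff_divide_distrib add_divide_distrib) simp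
    then have "dist (((LINT u|lborel. G u * J (t + h * u)) - J t) / h ^ Suc k) ?m \<le> e * C"
      using le hk unfolding dist_real_def by (simp only: abs_divide) (simp only: abs_of_pos pos_divide_le_eq)
    also have "\<dots> < e0" using e0 C by (simp add: e_def field_simps)
    finally show ?thesis .
  qed
  show "\<forall>\<^sub>F h in at_right 0. dist (((LINT u|lborel. G u * J (t + h * u)) - J t) / h ^ Suc k) ?m < e0"
    unfolding eventually_at_right_field using main d R by (intro exI[of _ "d / R"]) auto
qed

section \<open>Characteristic functions of step integrals\<close>

lemma cmod_iexp_minus_one_le: "cmod (iexp x - 1) \<le> \<bar>x\<bar>" "cmod (iexp x - 1) \<le> 2"
  using iexp_approx1[of x 0] iexp_approx2[of x 0] by auto

lemma (in prob_space) integrable_cmod_iexp_minus_one: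
  assumes [measurable]: "X \<in> borel_measurable M"
  shows "integrable M (\<lambda>\<omega>. cmod (iexp (X \<omega>) - 1))"
  by (rule integrable_const_bound[of _ 2]) (auto simp: cmod_iexp_minus_one_le)

lemma (in prob_space) char_distr:
  assumes [measurable]: "X \<in> borel_measurable M"
  shows "char (distr M borel X) u = (CLINT \<omega>|M. iexp (u * X \<omega>))"
  unfolding char_def by (subst integral_distr) auto

lemma (in prob_space) char_distr_add_const:
  assumes [measurable]: "X \<in> borel_measurable M"
  shows "char (distr M borel (\<lambda>\<omega>. X \<omega> + a)) u = iexp (u * a) * char (distr M borel X) u"
  by (simp add: char_distr distrib_left exp_add mult.commute)

lemma (in prob_space) char_distr_mult:
  assumes [measurable]: "X \<in> borel_measurable M"
  shows "char (distr M borel (\<lambda>\<omega>. a * X \<omega>)) u = char (distr M borel X) (u * a)"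
  by (simp add: char_distr mult.assoc)

text \<open>Factoring out the unimodular \<open>iexp (u * Y \<omega>)\<close> leaves a bounded
  function of the difference. Almost sure convergence and convergence in probability are both fed
  into characteristic functions through this one expectation, without any moment of \<open>X\<close>
  or \<open>Y\<close>.\<close>

lemma (in prob_space) norm_char_diff_le:
  assumes [measurable]: "X \<in> borel_measurable M" "Y \<in> borel_measurable M"
  shows "cmod (char (distr M borel X) u - char (distr M borel Y) u)
    \<le> expectation (\<lambda>\<omega>. cmod (iexp (u * (X \<omega> - Y \<omega>)) - 1))"
proof -
  have int: "integrable M (\<lambda>\<omega>. iexp (u * W \<omega>))" if [measurable]: "W \<in> borel_measurable M" for W
    by (rule integrable_const_bound[of _ 1]) auto
  have "char (distr M borel X) u - char (distr M borel Y) u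
      = (CLINT \<omega>|M. iexp (u * X \<omega>) - iexp (u * Y \<omega>))"
    unfolding char_distr[OF assms(1)] char_distr[OF assms(2)]
    by (rule Bochner_Integration.integral_diff[symmetric]; rule int) measurable
  also have "cmod \<dots> \<le> expectation (\<lambda>\<omega>. cmod (iexp (u * X \<omega>) - iexp (u * Y \<omega>)))"
    by (rule integral_norm_bound)
  also have "\<dots> = expectation (\<lambda>\<omega>. cmod (iexp (u * (X \<omega> - Y \<omega>)) - 1))"
  proof (intro Bochner_Integration.integral_cong refl)
    fix \<omega>
    have "iexp (u * X \<omega>) - iexp (u * Y \<omega>) = iexp (u * Y \<omega>) * (iexp (u * (X \<omega> - Y \<omega>)) - 1)"
      by (simp add: right_diff_distrib mult_exp_exp distrib_left)
    then show "cmod (iexp (u * X \<omega>) - iexp (u * Y \<omega>)) = cmod (iexp (u * (X \<omega> - Y \<omega>)) - 1)"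
      by (simp add: norm_mult)
  qed
  finally show ?thesis .
qed

lemma (in prob_space) expectation_iexp_AE_tendsto_0:
  assumes [measurable]: "\<And>n. X n \<in> borel_measurable M"
    and lim: "AE \<omega> in M. (\<lambda>n. X n \<omega>) \<longlonglongrightarrow> 0"
  shows "(\<lambda>n. expectation (\<lambda>\<omega>. cmod (iexp (u * X n \<omega>) - 1))) \<longlonglongrightarrow> 0"
proof -
  have "(\<lambda>n. expectation (\<lambda>\<omega>. cmod (iexp (u * X n \<omega>) - 1))) \<longlonglongrightarrow> expectation (\<lambda>\<omega>. 0 :: real)"
  proof (rule integral_dominated_convergence[where w = "\<lambda>_. 2"])
    show "AE \<omega> in M. (\<lambda>n. cmod (iexp (u * X n \<omega>) - 1)) \<longlonglongrightarrow> 0"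
      using lim
    proof eventually_elim
      case (elim \<omega>)
      have "(\<lambda>n. \<bar>u * X n \<omega>\<bar>) \<longlonglongrightarrow> 0" using tendsto_rabs[OF tendsto_mult[OF tendsto_const elim, of u]] by simp
      then show ?case by (rule Lim_null_comparison[rotated]) (intro always_eventually allI, simp only: real_norm_def abs_norm_cancel cmod_iexp_minus_one_le)
    qed
  qed (auto simp: cmod_iexp_minus_one_le simp del: of_real_mult)
  then show ?thesis by simp
qed

lemma (in prob_space) expectation_iexp_in_prob_tendsto_0:
  assumes [measurable]: "\<And>n. Y n \<in> borel_measurable M" "Y' \<in> borel_measurable M"
    and lim: "converges_in_prob M Y Y'"
  shows "(\<lambda>n. expectation (\<lambda>\<omega>. cmod (iexp (u * (Y n \<omega> - Y' \<omega>)) - 1))) \<longlonglongrightarrow> 0"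
proof (rule LIMSEQ_I)
  fix r :: real assume r: "0 < r"
  \<comment> \<open>Off the event \<open>B n\<close> the linear bound on \<open>iexp - 1\<close>
    contributes at most \<open>\<bar>u\<bar> * e\<close>, below \<open>r / 2\<close>; on it the
    bound 2 contributes at most \<open>2 * (r / 4)\<close>.\<close>
  define e where "e = r / (2 * (\<bar>u\<bar> + 1))"
  have e: "0 < e" using r by (simp add: e_def)
  have ue: "\<bar>u\<bar> * e < r / 2 + 0" using r by (simp add: e_def field_simps)
  define B where "B n = {\<omega>\<in>space M. \<bar>Y n \<omega> - Y' \<omega>\<bar> > e}" for n
  have [measurable]: "B n \<in> sets M" for n unfolding B_def by measurable
  have "(\<lambda>n. prob (B n)) \<longlonglongrightarrow> 0" using lim e unfolding converges_in_prob_def B_def by auto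
  then obtain n0 where n0: "\<And>n. n \<ge> n0 \<Longrightarrow> prob (B n) < r / 4"
    using r LIMSEQ_D[of "\<lambda>n. prob (B n)" 0 "r / 4"] by auto
  have "expectation (\<lambda>\<omega>. cmod (iexp (u * (Y n \<omega> - Y' \<omega>)) - 1)) < r" if n: "n \<ge> n0" for n
  proof -
    have "expectation (\<lambda>\<omega>. cmod (iexp (u * (Y n \<omega> - Y' \<omega>)) - 1))
        \<le> expectation (\<lambda>\<omega>. \<bar>u\<bar> * e + 2 * indicator (B n) \<omega>)"
    proof (rule integral_mono)
      show "integrable M (\<lambda>\<omega>. cmod (iexp (u * (Y n \<omega> - Y' \<omega>)) - 1))"
        by (rule integrable_cmod_iexp_minus_one) measurable
      show "integrable M (\<lambda>\<omega>. \<bar>u\<bar> * e + 2 * indicator (B n) \<omega>)"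
        by (auto simp: finite_measure.emeasure_finite less_top[symmetric])
      fix \<omega> assume "\<omega> \<in> space M"
      then show "cmod (iexp (u * (Y n \<omega> - Y' \<omega>)) - 1) \<le> \<bar>u\<bar> * e + 2 * indicator (B n) \<omega>"
      proof (cases "\<omega> \<in> B n")
        case True
        then show ?thesis using cmod_iexp_minus_one_le(2)[of "u * (Y n \<omega> - Y' \<omega>)"] e
          by (simp add: add_increasing del: of_real_mult)
      next
        case False
        then have "\<bar>Y n \<omega> - Y' \<omega>\<bar> \<le> e" using \<open>\<omega> \<in> space M\<close> by (simp add: B_def)
        then have "\<bar>u * (Y n \<omega> - Y' \<omega>)\<bar> \<le> \<bar>u\<bar> * e" unfolding abs_mult by (rule mult_left_mono) simp
        then show ?thesis using cmod_iexp_minus_one_le(1)[of "u * (Y n \<omega> - Y' \<omega>)"] False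
          by (simp del: of_real_mult)
      qed
    qed
    also have "\<dots> = \<bar>u\<bar> * e + 2 * prob (B n)"
      by (subst Bochner_Integration.integral_add) (auto simp: prob_space less_top[symmetric])
    also have "\<dots> < r" using ue n0[OF n] by simp
    finally show ?thesis .
  qed
  moreover have "0 \<le> expectation (\<lambda>\<omega>. cmod (iexp (u * (Y n \<omega> - Y' \<omega>)) - 1))" for n by simp
  ultimately show "\<exists>no. \<forall>n\<ge>no. norm (expectation (\<lambda>\<omega>. cmod (iexp (u * (Y n \<omega> - Y' \<omega>)) - 1)) - 0) < r"
    by (intro exI[of _ n0]) auto
qed

section \<open>Sums of independent stable increments\<close>

lemma char_stable_law:
  assumes "has_stable_law M Y \<alpha> \<sigma> \<beta> 0"
  shows "char (distr M borel Y) u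
    = exp (- complex_of_real (\<sigma> powr \<alpha>) * stable_exponent \<alpha> (\<beta> * tan (\<alpha> * pi / 2)) u)"
  using assms by (simp add: has_stable_law_def stable_exponent_def mult_ac)

lemma right_continuous_filtration_measurable:
  assumes "right_continuous_filtration M F" "0 \<le> s" "Y \<in> borel_measurable (F s)"
  shows "Y \<in> borel_measurable M"
  using assms measurable_from_subalg unfolding right_continuous_filtration_def by blast

text \<open>The scale of an increment is the power \<open>1 / \<alpha>\<close> of its length, so its
  characteristic exponent is linear in the length, and independence adds the exponents up. No upper
  end is imposed on the partition, which leaves room for moving its points to the right.\<close>

lemma (in prob_space) char_step_integral_levy:
  assumes F: "right_continuous_filtration M F" and Z: "standard_stable_levy M F \<alpha> \<beta> Z"
    and \<alpha>: "0 < \<alpha>" and p: "0 \<le> p 0" "\<And>i. i < n \<Longrightarrow> p i \<le> p (Suc i)"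
  shows "char (distr M borel (step_integral n p c Z)) u
    = exp (- (\<Sum>i<n. complex_of_real (p (Suc i) - p i) * stable_exponent \<alpha> (\<beta> * tan (\<alpha> * pi / 2)) (u * c i)))"
proof -
  let ?\<psi> = "stable_exponent \<alpha> (\<beta> * tan (\<alpha> * pi / 2))"
  have Zm [measurable]: "Z s \<in> borel_measurable M" if "0 \<le> s" for s
    using Z that by (intro right_continuous_filtration_measurable[OF F that]) (auto simp: standard_stable_levy_def)
  have strict: "char (distr M borel (step_integral n q c Z)) u
      = exp (- (\<Sum>i<n. complex_of_real (q (Suc i) - q i) * ?\<psi> (u * c i)))"
    if q: "0 \<le> q 0" "\<And>i. i < n \<Longrightarrow> q i < q (Suc i)" for q
  proof -
    have q0: "0 \<le> q i" if "i \<le> n" for i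
      using that
    proof (induction i)
      case (Suc i)
      then show ?case using q(2)[of i] by simp
    qed (use q in simp)
    have "indep_vars (\<lambda>_. borel) (\<lambda>i \<omega>. Z (q (Suc i)) \<omega> - Z (q i) \<omega>) {..<n}"
      using Z q unfolding standard_stable_levy_def independent_increments_def by blast
    then have ind: "indep_vars (\<lambda>_. borel) (\<lambda>i \<omega>. c i * (Z (q (Suc i)) \<omega> - Z (q i) \<omega>)) {..<n}"
      by (rule indep_vars_compose2) measurable
    have "char (distr M borel (step_integral n q c Z)) u
        = (\<Prod>i<n. char (distr M borel (\<lambda>\<omega>. c i * (Z (q (Suc i)) \<omega> - Z (q i) \<omega>))) u)"
      unfolding char_distr_sum[OF ind, symmetric] step_integral_def ..
    also have "\<dots> = (\<Prod>i<n. exp (- (complex_of_real (q (Suc i) - q i) * ?\<psi> (u * c i))))"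
    proof (rule prod.cong[OF refl])
      fix i assume i: "i \<in> {..<n}"
      then have pos: "0 \<le> q i" "q i < q (Suc i)" "0 \<le> q (Suc i)" using q q0[of i] q0[of "Suc i"] by auto
      have [measurable]: "Z (q i) \<in> borel_measurable M" "Z (q (Suc i)) \<in> borel_measurable M"
        using pos by auto
      have "char (distr M borel (\<lambda>\<omega>. c i * (Z (q (Suc i)) \<omega> - Z (q i) \<omega>))) u
          = char (distr M borel (\<lambda>\<omega>. Z (q (Suc i)) \<omega> - Z (q i) \<omega>)) (u * c i)"
        by (simp add: char_distr mult.assoc)
      also have law: "has_stable_law M (\<lambda>\<omega>. Z (q (Suc i)) \<omega> - Z (q i) \<omega>) \<alpha> ((q (Suc i) - q i) powr (1 / \<alpha>)) \<beta> 0"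
        using Z pos unfolding standard_stable_levy_def by blast
      have pw: "((q (Suc i) - q i) powr (1 / \<alpha>)) powr \<alpha> = q (Suc i) - q i"
        using \<alpha> pos by (simp add: powr_powr)
      from char_stable_law[OF law]
      have "char (distr M borel (\<lambda>\<omega>. Z (q (Suc i)) \<omega> - Z (q i) \<omega>)) (u * c i)
          = exp (- (complex_of_real (q (Suc i) - q i) * ?\<psi> (u * c i)))"
        by (simp only: pw mult_minus_left)
      finally show "char (distr M borel (\<lambda>\<omega>. c i * (Z (q (Suc i)) \<omega> - Z (q i) \<omega>))) u
          = exp (- (complex_of_real (q (Suc i) - q i) * ?\<psi> (u * c i)))" .
    qed
    also have "\<dots> = exp (- (\<Sum>i<n. complex_of_real (q (Suc i) - q i) * ?\<psi> (u * c i)))"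
      by (simp add: exp_sum sum_negf[symmetric])
    finally show ?thesis .
  qed
  \<comment> \<open>Coinciding partition points are separated by a shift to the right, which right-continuity
    of the paths removes in the limit.\<close>
  define q where "q k i = p i + real i * inverse (real (Suc k))" for k i
  have q: "q k i < q k (Suc i)" if "i < n" for k i
  proof -
    have "0 < inverse (real (Suc k))" by simp
    then show ?thesis using p(2)[OF that] unfolding q_def of_nat_Suc[of i] distrib_right by linarith
  qed
  have p0: "0 \<le> p i" if "i \<le> n" for i
    using that
    proof (induction i)
      case (Suc i)
      then show ?case using p(2)[of i] by simp
    qed (use p in simp)
  have q_nonneg: "0 \<le> q k i" if "i \<le> n" for k i using p0[OF that] by (simp add: q_def)
  have q_lim: "(\<lambda>k. q k i) \<longlonglongrightarrow> p i" for i
    unfolding q_def using tendsto_add[OF tendsto_const tendsto_mult[OF tendsto_const LIMSEQ_inverse_real_of_nat], of "p i" "real i"] by simp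
  have [measurable]: "step_integral n (q k) c Z \<in> borel_measurable M" for k
    unfolding step_integral_def[abs_def] using q_nonneg by (auto intro!: borel_measurable_sum borel_measurable_times borel_measurable_diff Zm)
  have [measurable]: "step_integral n p c Z \<in> borel_measurable M"
    unfolding step_integral_def[abs_def] using p0 by (auto intro!: borel_measurable_sum borel_measurable_times borel_measurable_diff Zm)
  have "AE \<omega> in M. cadlag_on {0..} (\<lambda>t. Z t \<omega>)" using Z by (simp add: standard_stable_levy_def)
  then have AE: "AE \<omega> in M. (\<lambda>k. step_integral n (q k) c Z \<omega> - step_integral n p c Z \<omega>) \<longlonglongrightarrow> 0"
  proof eventually_elim
    case (elim \<omega>)
    have "(\<lambda>k. Z (q k i) \<omega>) \<longlonglongrightarrow> Z (p i) \<omega>" if i: "i \<le> n" for i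
    proof (cases i)
      case 0
      then show ?thesis by (simp add: q_def)
    next
      case (Suc j)
      have "((\<lambda>t. Z t \<omega>) \<longlongrightarrow> Z (p i) \<omega>) (at (p i) within ({0..} \<inter> {p i<..}))"
        using elim p0[OF i] unfolding cadlag_on_def by auto
      moreover have "p i < q k i" for k using Suc by (simp add: q_def)
      ultimately show ?thesis using q_lim[of i] q_nonneg[OF i]
        unfolding tendsto_at_iff_sequentially comp_def by (auto simp: less_imp_neq[symmetric])
    qed
    then have "(\<lambda>k. step_integral n (q k) c Z \<omega>) \<longlonglongrightarrow> step_integral n p c Z \<omega>"
      unfolding step_integral_def by (intro tendsto_sum tendsto_mult tendsto_diff tendsto_const) auto
    then show ?case by (simp add: LIM_zero_iff)
  qed
  have "(\<lambda>k. char (distr M borel (step_integral n (q k) c Z)) u - char (distr M borel (step_integral n p c Z)) u) \<longlonglongrightarrow> 0"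
  proof (rule Lim_null_comparison[OF always_eventually[OF allI]])
    show "cmod (char (distr M borel (step_integral n (q k) c Z)) u - char (distr M borel (step_integral n p c Z)) u)
        \<le> expectation (\<lambda>\<omega>. cmod (iexp (u * (step_integral n (q k) c Z \<omega> - step_integral n p c Z \<omega>)) - 1))" for k
      by (rule norm_char_diff_le) measurable
  qed (rule expectation_iexp_AE_tendsto_0[OF _ AE], measurable)
  then have "(\<lambda>k. char (distr M borel (step_integral n (q k) c Z)) u) \<longlonglongrightarrow> char (distr M borel (step_integral n p c Z)) u"
    by (simp add: LIM_zero_iff)
  moreover have "(\<lambda>k. char (distr M borel (step_integral n (q k) c Z)) u)
      = (\<lambda>k. exp (- (\<Sum>i<n. complex_of_real (q k (Suc i) - q k i) * ?\<psi> (u * c i))))"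
    using q_nonneg[of 0] by (intro ext strict q) simp
  moreover have "(\<lambda>k. exp (- (\<Sum>i<n. complex_of_real (q k (Suc i) - q k i) * ?\<psi> (u * c i))))
      \<longlonglongrightarrow> exp (- (\<Sum>i<n. complex_of_real (p (Suc i) - p i) * ?\<psi> (u * c i)))"
    by (intro tendsto_intros q_lim)
  ultimately show ?thesis by (intro LIMSEQ_unique) simp_all
qed

section \<open>Stochastic integrals of deterministic functions\<close>

text \<open>The bounds \<open>B n\<close> may grow with \<open>n\<close>; they only ensure that the
  integrals exist. The convergence is measured by the L^\<alpha> distance alone. The first limit
  serves the drift part, the second the noise part.\<close>

lemma (in finite_measure)
  fixes f :: "'a \<Rightarrow> real"
  assumes \<alpha>: "1 < \<alpha>"
    and s [measurable]: "\<And>n. s n \<in> borel_measurable M" and sB: "\<And>n x. \<bar>s n x\<bar> \<le> B n"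
    and f [measurable]: "f \<in> borel_measurable M" and fK: "\<And>x. \<bar>f x\<bar> \<le> K"
    and lim: "(\<lambda>n. \<integral>\<^sup>+x. ennreal (\<bar>s n x - f x\<bar> powr \<alpha>) \<partial>M) \<longlonglongrightarrow> 0"
  shows tendsto_L1_of_L_powr: "(\<lambda>n. LINT x|M. \<bar>s n x - f x\<bar>) \<longlonglongrightarrow> 0"
    and tendsto_stable_exponent_of_L_powr:
      "(\<lambda>n. LINT x|M. stable_exponent \<alpha> \<kappa> (u * s n x)) \<longlonglongrightarrow> (LINT x|M. stable_exponent \<alpha> \<kappa> (u * f x))"
proof -
  define a where "a n = (LINT x|M. \<bar>s n x - f x\<bar> powr \<alpha>)" for n
  have diff_le: "\<bar>s n x - f x\<bar> \<le> B n + K" for n x using sB[of n x] fK[of x] by linarith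
  have int_diff: "integrable M (\<lambda>x. \<bar>s n x - f x\<bar> powr \<alpha>)" for n
    by (rule integrable_const_bound[of _ "(B n + K) powr \<alpha>"]) (use diff_le \<alpha> in \<open>auto intro!: powr_mono2\<close>)
  have int_diff1: "integrable M (\<lambda>x. \<bar>s n x - f x\<bar>)" for n
    by (rule integrable_const_bound[of _ "B n + K"]) (use diff_le in auto)
  have int_f: "integrable M (\<lambda>x. \<bar>u * f x\<bar> powr \<alpha>)" for u
    by (rule integrable_const_bound[of _ "(\<bar>u\<bar> * K) powr \<alpha>"])
       (use fK \<alpha> in \<open>auto intro!: powr_mono2 mult_left_mono simp: abs_mult\<close>)
  have "(\<lambda>n. ennreal (a n)) \<longlonglongrightarrow> ennreal 0"
    using lim int_diff by (simp add: a_def nn_integral_eq_integral)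
  moreover have a0: "0 \<le> a n" for n by (simp add: a_def)
  ultimately have a: "a \<longlonglongrightarrow> 0" by (subst (asm) tendsto_ennreal_iff) auto
  \<comment> \<open>The common pattern of both limits: a fixed quantity \<open>W\<close> times an
    arbitrarily small \<open>d\<close>, plus the L^\<alpha> distance times a constant that may blow
    up as \<open>d\<close> shrinks. Choosing \<open>d\<close> before \<open>n\<close> gives
    convergence.\<close>
  have squeeze: "(\<lambda>n. b n) \<longlonglongrightarrow> 0"
    if b: "\<And>d. 0 < d \<Longrightarrow> \<exists>C. \<forall>n. \<bar>b n\<bar> \<le> d * W + C * a n" and W: "0 \<le> W" for b :: "nat \<Rightarrow> real" and W
  proof (rule LIMSEQ_I)
    fix r :: real assume r: "0 < r"
    define d where "d = r / (2 * (W + 1))"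
    have d: "0 < d" "d * W \<le> r / 2" using r W by (auto simp: d_def field_simps)
    obtain C where C: "\<And>n. \<bar>b n\<bar> \<le> d * W + C * a n" using b[OF d(1)] by blast
    have "(\<lambda>n. C * a n) \<longlonglongrightarrow> 0" using tendsto_mult_right[OF a, of C] by (simp add: mult.commute)
    then obtain n0 where "\<And>n. n \<ge> n0 \<Longrightarrow> \<bar>C * a n\<bar> < r / 2"
      using r LIMSEQ_D[of "\<lambda>n. C * a n" 0 "r / 2"] by auto
    then have "\<bar>b n\<bar> < r" if "n \<ge> n0" for n
      using that C[of n] d(2) by (smt (verit) field_sum_of_halves)
    then show "\<exists>no. \<forall>n\<ge>no. norm (b n - 0) < r" by auto
  qed
  show "(\<lambda>n. LINT x|M. \<bar>s n x - f x\<bar>) \<longlonglongrightarrow> 0"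
  proof (rule squeeze[of _ "measure M (space M)"])
    fix d :: real assume d: "0 < d"
    \<comment> \<open>Beyond the threshold \<open>d\<close>, the factor
      \<open>\<bar>y\<bar> powr (1 - \<alpha>)\<close> is at most
      \<open>d powr (1 - \<alpha>)\<close>, because \<alpha> exceeds 1.\<close>
    have pt: "\<bar>y\<bar> \<le> d + d powr (1 - \<alpha>) * \<bar>y\<bar> powr \<alpha>" for y :: real
    proof (cases "\<bar>y\<bar> \<le> d")
      case True
      then show ?thesis by (simp add: add_increasing2)
    next
      case False
      then have "\<bar>y\<bar> = \<bar>y\<bar> powr (1 - \<alpha>) * \<bar>y\<bar> powr \<alpha>" using d by (simp add: powr_add[symmetric])
      also have "\<dots> \<le> d powr (1 - \<alpha>) * \<bar>y\<bar> powr \<alpha>"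
        using False d \<alpha> by (intro mult_right_mono powr_mono2') auto
      finally show ?thesis using d by linarith
    qed
    have "\<bar>LINT x|M. \<bar>s n x - f x\<bar>\<bar> \<le> d * measure M (space M) + d powr (1 - \<alpha>) * a n" for n
    proof -
      have "(LINT x|M. \<bar>s n x - f x\<bar>) \<le> (LINT x|M. d + d powr (1 - \<alpha>) * \<bar>s n x - f x\<bar> powr \<alpha>)"
        by (intro integral_mono pt int_diff1) (auto intro!: int_diff)
      also have "\<dots> = d * measure M (space M) + d powr (1 - \<alpha>) * a n"
        by (subst Bochner_Integration.integral_add) (auto simp: a_def int_diff)
      finally show ?thesis by simp
    qed
    then show "\<exists>C. \<forall>n. \<bar>LINT x|M. \<bar>s n x - f x\<bar>\<bar> \<le> d * measure M (space M) + C * a n" by blast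
  qed simp
  let ?\<psi> = "stable_exponent \<alpha> \<kappa>"
  have int\<psi>: "integrable M (\<lambda>x. ?\<psi> (g x))" if [measurable]: "g \<in> borel_measurable M" and g: "\<And>x. \<bar>g x\<bar> \<le> R" for g R
  proof (rule integrable_const_bound[of _ "(1 + \<bar>\<kappa>\<bar>) * R powr \<alpha>"])
    show "AE x in M. cmod (?\<psi> (g x)) \<le> (1 + \<bar>\<kappa>\<bar>) * R powr \<alpha>"
      using g \<alpha> by (intro AE_I2 order_trans[OF norm_stable_exponent_le] mult_left_mono powr_mono2) auto
  qed measurable
  have int1: "integrable M (\<lambda>x. ?\<psi> (u * s n x))" for n
    using sB by (intro int\<psi>[of _ "\<bar>u\<bar> * B n"]) (auto simp: abs_mult intro!: mult_left_mono)
  have int2: "integrable M (\<lambda>x. ?\<psi> (u * f x))"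
    using fK by (intro int\<psi>[of _ "\<bar>u\<bar> * K"]) (auto simp: abs_mult intro!: mult_left_mono)
  have "(\<lambda>n. cmod ((LINT x|M. ?\<psi> (u * s n x)) - (LINT x|M. ?\<psi> (u * f x)))) \<longlonglongrightarrow> 0"
  proof (rule squeeze[of _ "LINT x|M. \<bar>u * f x\<bar> powr \<alpha>"])
    fix d :: real assume d: "0 < d"
    obtain C where C: "0 \<le> C" "\<And>a b. cmod (?\<psi> a - ?\<psi> b) \<le> d * \<bar>b\<bar> powr \<alpha> + C * \<bar>a - b\<bar> powr \<alpha>"
      using stable_exponent_diff_le[of \<alpha> d \<kappa>] \<alpha> d by (metis less_trans zero_less_one)
    have "cmod ((LINT x|M. ?\<psi> (u * s n x)) - (LINT x|M. ?\<psi> (u * f x)))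
        \<le> d * (LINT x|M. \<bar>u * f x\<bar> powr \<alpha>) + (C * \<bar>u\<bar> powr \<alpha>) * a n" for n
    proof -
      have "cmod ((LINT x|M. ?\<psi> (u * s n x)) - (LINT x|M. ?\<psi> (u * f x)))
          = cmod (LINT x|M. ?\<psi> (u * s n x) - ?\<psi> (u * f x))"
        using int1 int2 by simp
      also have "\<dots> \<le> (LINT x|M. cmod (?\<psi> (u * s n x) - ?\<psi> (u * f x)))" by (rule integral_norm_bound)
      also have "\<dots> \<le> (LINT x|M. d * \<bar>u * f x\<bar> powr \<alpha> + (C * \<bar>u\<bar> powr \<alpha>) * \<bar>s n x - f x\<bar> powr \<alpha>)"
      proof (rule integral_mono)
        show "integrable M (\<lambda>x. cmod (?\<psi> (u * s n x) - ?\<psi> (u * f x)))" using int1 int2 by auto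
        show "integrable M (\<lambda>x. d * \<bar>u * f x\<bar> powr \<alpha> + (C * \<bar>u\<bar> powr \<alpha>) * \<bar>s n x - f x\<bar> powr \<alpha>)"
          by (intro Bochner_Integration.integrable_add integrable_mult_right int_f int_diff)
        show "cmod (?\<psi> (u * s n x) - ?\<psi> (u * f x))
            \<le> d * \<bar>u * f x\<bar> powr \<alpha> + (C * \<bar>u\<bar> powr \<alpha>) * \<bar>s n x - f x\<bar> powr \<alpha>" for x
          using C(2)[of "u * s n x" "u * f x"]
          by (simp add: right_diff_distrib[symmetric] abs_mult powr_mult mult.assoc)
      qed
      also have "\<dots> = d * (LINT x|M. \<bar>u * f x\<bar> powr \<alpha>) + (C * \<bar>u\<bar> powr \<alpha>) * a n"
        unfolding a_def by (subst Bochner_Integration.integral_add) (auto intro!: int_f int_diff integrable_mult_right simp del: abs_mult)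
      finally show ?thesis .
    qed
    then show "\<exists>C. \<forall>n. \<bar>cmod ((LINT x|M. ?\<psi> (u * s n x)) - (LINT x|M. ?\<psi> (u * f x)))\<bar>
        \<le> d * (LINT x|M. \<bar>u * f x\<bar> powr \<alpha>) + C * a n" by (intro exI[of _ "C * \<bar>u\<bar> powr \<alpha>"]) simp
  qed simp
  then show "(\<lambda>n. LINT x|M. ?\<psi> (u * s n x)) \<longlonglongrightarrow> (LINT x|M. ?\<psi> (u * f x))"
    by (simp add: tendsto_norm_zero_iff LIM_zero_iff)
qed

section \<open>Step functions and their integrals\<close>

lemma step_fun_measurable [measurable]: "step_fun n p c \<in> borel_measurable borel"
  unfolding step_fun_def[abs_def] by measurable

lemma abs_step_fun_le: "\<bar>step_fun n p c x\<bar> \<le> (\<Sum>i<n. \<bar>c i\<bar>)"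
  unfolding step_fun_def
  by (rule order_trans[OF sum_abs]) (auto intro!: sum_mono simp: indicator_def)

text \<open>The half-open cells are disjoint, so at most one summand of the step function is nonzero
  and \<open>g\<close> passes through the sum; \<open>g 0 = 0\<close> takes care of points outside
  all cells. Empty cells are harmless.\<close>

lemma step_fun_comp:
  fixes g :: "real \<Rightarrow> 'b::real_vector"
  assumes "g 0 = 0" "\<And>i. i < n \<Longrightarrow> p i \<le> p (Suc i)"
  shows "g (step_fun n p c x) = (\<Sum>i<n. indicat_real {p i<..p (Suc i)} x *\<^sub>R g (c i))"
proof -
  have mono: "p i \<le> p j" if "i \<le> j" "j \<le> m" "\<And>i. i < m \<Longrightarrow> p i \<le> p (Suc i)" for i j m
    using that by (induction j rule: dec_induct) (auto intro: order_trans)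
  show ?thesis using assms(2)
  proof (induction n)
    case (Suc n)
    show ?case
    proof (cases "x \<in> {p n<..p (Suc n)}")
      case True
      have "x \<notin> {p i<..p (Suc i)}" if "i < n" for i
        using mono[of "Suc i" n n] that Suc.prems True by fastforce
      then show ?thesis using True by (simp add: step_fun_def)
    next
      case False
      have "g (step_fun n p c x) = (\<Sum>i<n. indicat_real {p i<..p (Suc i)} x *\<^sub>R g (c i))"
        using Suc by auto
      then show ?thesis using False by (simp add: step_fun_def)
    qed
  qed (simp add: step_fun_def assms(1))
qed

lemma partition_mem:
  fixes p :: "nat \<Rightarrow> real"
  assumes "0 \<le> p 0" "p n \<le> T" "\<And>i. i < n \<Longrightarrow> p i \<le> p (Suc i)" "j \<le> n"
  shows "p j \<in> {0..T}"
proof -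
  have "p 0 \<le> p j" using assms(4) by (induction j) (use assms(3) in \<open>auto intro: order_trans\<close>)
  moreover have "p j \<le> p n"
    using assms(4) by (induction rule: inc_induct) (use assms(3) in \<open>auto intro: order_trans\<close>)
  ultimately show ?thesis using assms by auto
qed

text \<open>Recasts the exponent found for a step integral as an integral of the step function
  itself, the form in which the L^\<alpha> limit can be taken.\<close>

lemma integral_stable_exponent_step_fun:
  assumes "0 \<le> p 0" "p n \<le> T" and p: "\<And>i. i < n \<Longrightarrow> p i \<le> p (Suc i)"
  shows "(LINT x|restrict_space lborel {0..T}. stable_exponent \<alpha> \<kappa> (u * step_fun n p c x))
    = (\<Sum>i<n. complex_of_real (p (Suc i) - p i) * stable_exponent \<alpha> \<kappa> (u * c i))"
proof -
  let ?M = "restrict_space lborel {0..T}"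
  note mem = partition_mem[OF assms]
  have sub: "{p i<..p (Suc i)} \<subseteq> {0..T}" if "i < n" for i using mem[of i] mem[of "Suc i"] that by auto
  have set: "{p i<..p (Suc i)} \<in> sets ?M" if "i < n" for i
    using sub[OF that] by (auto simp: sets_restrict_space_iff)
  have meas: "measure ?M {p i<..p (Suc i)} = p (Suc i) - p i" if "i < n" for i
    using sub[OF that] p[OF that] by (simp add: measure_restrict_space)
  have fin: "emeasure ?M {p i<..p (Suc i)} < \<infinity>" if "i < n" for i
    using sub[OF that] p[OF that] by (simp add: emeasure_restrict_space)
  have "(LINT x|?M. stable_exponent \<alpha> \<kappa> (u * step_fun n p c x))
      = (LINT x|?M. (\<Sum>i<n. indicat_real {p i<..p (Suc i)} x *\<^sub>R stable_exponent \<alpha> \<kappa> (u * c i)))"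
    using step_fun_comp[of "\<lambda>y. stable_exponent \<alpha> \<kappa> (u * y)" n p] p by simp
  also have "\<dots> = (\<Sum>i<n. LINT x|?M. indicat_real {p i<..p (Suc i)} x *\<^sub>R stable_exponent \<alpha> \<kappa> (u * c i))"
    by (rule Bochner_Integration.integral_sum)
       (auto intro!: integrable_scaleR_left integrable_real_indicator set fin)
  also have "\<dots> = (\<Sum>i<n. complex_of_real (p (Suc i) - p i) * stable_exponent \<alpha> \<kappa> (u * c i))"
    using set fin meas Int_absorb2[OF sub] by (intro sum.cong refl, subst integral_scaleR_left)
      (auto intro!: integrable_real_indicator simp: scaleR_conv_of_real)
  finally show ?thesis .
qed

text \<open>A statement about a single path. Over each cell the increments of \<open>X\<close> and
  \<open>Z\<close> differ by the drift accumulated there, and \<open>x0\<close> cancels.\<close>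

lemma step_integral_drift:
  fixes X Z :: "real \<Rightarrow> 'a \<Rightarrow> real"
  assumes "0 \<le> p 0" "p n \<le> T" and p: "\<And>i. i < n \<Longrightarrow> p i \<le> p (Suc i)"
    and g: "set_integrable lborel {0..T} g"
    and X: "\<And>s. s \<in> {0..T} \<Longrightarrow> X s \<omega> = x0 + (LINT r:{0..s}|lborel. g r) + \<epsilon> * Z s \<omega>"
  shows "step_integral n p c X \<omega> - \<epsilon> * step_integral n p c Z \<omega>
    = (LINT r:{0..T}|lborel. step_fun n p c r * g r)"
proof -
  note mem = partition_mem[OF assms(1,2) p]
  have int: "set_integrable lborel A g" if "A \<in> sets lborel" "A \<subseteq> {0..T}" for A
    using set_integrable_subset[OF g that] .
  have inc: "(X (p (Suc i)) \<omega> - X (p i) \<omega>) - \<epsilon> * (Z (p (Suc i)) \<omega> - Z (p i) \<omega>) = (LINT r:{p i<..p (Suc i)}|lborel. g r)"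
    if i: "i < n" for i
  proof -
    have m: "p i \<in> {0..T}" "p (Suc i) \<in> {0..T}" using mem i by auto
    have "{0..p (Suc i)} = {0..p i} \<union> {p i<..p (Suc i)}" using m p[OF i] by auto
    then have "(LINT r:{0..p (Suc i)}|lborel. g r) = (LINT r:{0..p i}|lborel. g r) + (LINT r:{p i<..p (Suc i)}|lborel. g r)"
      using m by (simp only:) (subst set_integral_Un, auto intro!: int)
    then show ?thesis using X[OF m(1)] X[OF m(2)] by (simp add: algebra_simps)
  qed
  have "step_integral n p c X \<omega> - \<epsilon> * step_integral n p c Z \<omega>
      = (\<Sum>i<n. c i * ((X (p (Suc i)) \<omega> - X (p i) \<omega>) - \<epsilon> * (Z (p (Suc i)) \<omega> - Z (p i) \<omega>)))"
    unfolding step_integral_def sum_distrib_left sum_subtractf[symmetric]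
    by (intro sum.cong refl) (simp add: algebra_simps)
  also have "\<dots> = (\<Sum>i<n. LINT r|lborel. c i * (indicator {p i<..p (Suc i)} r * g r))"
    using inc by (intro sum.cong refl) (simp add: set_lebesgue_integral_def)
  also have "\<dots> = (LINT r|lborel. (\<Sum>i<n. c i * (indicator {p i<..p (Suc i)} r * g r)))"
  proof (rule Bochner_Integration.integral_sum[symmetric])
    fix i assume "i \<in> {..<n}"
    then have "set_integrable lborel {p i<..p (Suc i)} g" using mem[of i] mem[of "Suc i"] by (intro int) auto
    then show "integrable lborel (\<lambda>r. c i * (indicator {p i<..p (Suc i)} r * g r))"
      by (simp add: set_integrable_def)
  qed
  also have "\<dots> = (LINT r:{0..T}|lborel. step_fun n p c r * g r)"
    unfolding set_lebesgue_integral_def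
  proof (intro Bochner_Integration.integral_cong refl)
    fix r
    have "r \<notin> {p i<..p (Suc i)}" if "i < n" "r \<notin> {0..T}" for i
      using mem[of i] mem[of "Suc i"] that by auto
    then show "(\<Sum>i<n. c i * (indicator {p i<..p (Suc i)} r * g r)) = indicat_real {0..T} r *\<^sub>R (step_fun n p c r * g r)"
      unfolding step_fun_def sum_distrib_right by (cases "r \<in> {0..T}") (auto simp: mult.assoc)
  qed
  finally show ?thesis .
qed

section \<open>Drift and noise in an integral against the solution\<close>

lemma cadlag_on_mult_integrable:
  assumes f: "cadlag_on {a..b} f" and \<theta>: "continuous_on {a..b} \<theta>"
  shows "set_integrable lborel {a..b} (\<lambda>s. \<theta> s * f s)"
proof -
  obtain S where S: "0 \<le> S" "\<And>s. s \<in> {a..b} \<Longrightarrow> \<bar>f s\<bar> \<le> S" using cadlag_on_bounded[OF f] by blast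
  have [measurable]: "(\<lambda>s. indicator {a..b} s * f s) \<in> borel_measurable borel"
    by (rule cadlag_on_measurable[OF f])
  have int: "integrable lborel (\<lambda>s. indicator {a..b} s * \<theta> s)"
    using borel_integrable_atLeastAtMost'[OF \<theta>] by (simp add: set_integrable_def)
  then have [measurable]: "(\<lambda>s. indicator {a..b} s * \<theta> s) \<in> borel_measurable borel" by auto
  have eq: "(\<lambda>s. indicator {a..b} s *\<^sub>R (\<theta> s * f s)) = (\<lambda>s. (indicator {a..b} s * \<theta> s) * (indicator {a..b} s * f s))"
    by (auto simp: indicator_def)
  show ?thesis unfolding set_integrable_def eq
  proof (rule Bochner_Integration.integrable_bound)
    show "integrable lborel (\<lambda>s. S * (indicator {a..b} s * \<theta> s))" using int by simp
    show "AE s in lborel. norm ((indicator {a..b} s * \<theta> s) * (indicator {a..b} s * f s))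
        \<le> norm (S * (indicator {a..b} s * \<theta> s))"
      using S by (intro AE_I2) (auto simp: indicator_def abs_mult mult.commute[of S] intro!: mult_left_mono)
  qed measurable
qed

text \<open>The noise is what is left of \<open>Y\<close> after removing the drift \<open>D\<close>,
  so that it needs no integral of its own. Its law comes from the elementary integrals of
  \<open>Z\<close> along the very partitions that define \<open>Y\<close>.\<close>

lemma (in prob_space) stoch_integral_split:
  assumes F: "right_continuous_filtration M F" and Z: "standard_stable_levy M F \<alpha> \<beta> Z"
    and \<alpha>: "1 < \<alpha>" and X: "solves_sde M F T \<theta> x0 \<epsilon> Z X"
    and \<theta>: "continuous_on {0..T} \<theta>"
    and f [measurable]: "f \<in> borel_measurable borel" and fK: "\<And>x. \<bar>f x\<bar> \<le> K"
    and Y: "has_stoch_integral M \<alpha> T f X Y"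
  obtains D where "D \<in> borel_measurable M"
    "AE \<omega> in M. D \<omega> = (LINT s:{0..T}|lborel. f s * (\<theta> s * X s \<omega>))"
    "\<And>u. char (distr M borel (\<lambda>\<omega>. Y \<omega> - D \<omega>)) u = exp (- (LINT s|restrict_space lborel {0..T}.
        stable_exponent \<alpha> (\<beta> * tan (\<alpha> * pi / 2)) (u * \<epsilon> * f s)))"
proof -
  let ?M = "restrict_space lborel {0..T}"
  let ?\<psi> = "stable_exponent \<alpha> (\<beta> * tan (\<alpha> * pi / 2))"
  interpret I: finite_measure ?M
    by (rule finite_measureI) (simp add: emeasure_restrict_space space_restrict_space emeasure_lborel_Icc_eq)
  obtain N p c where p: "\<And>n. 0 \<le> p n 0" "\<And>n. p n (N n) \<le> T" "\<And>n i. i < N n \<Longrightarrow> p n i \<le> p n (Suc i)"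
    and L: "(\<lambda>n. \<integral>\<^sup>+u\<in>{0..T}. ennreal (\<bar>step_fun (N n) (p n) (c n) u - f u\<bar> powr \<alpha>) \<partial>lborel) \<longlonglongrightarrow> 0"
    and prob: "converges_in_prob M (\<lambda>n. step_integral (N n) (p n) (c n) X) Y"
    and [measurable]: "Y \<in> borel_measurable M"
    using Y unfolding has_stoch_integral_def by blast
  define s where "s n = step_fun (N n) (p n) (c n)" for n
  define SX where "SX n = step_integral (N n) (p n) (c n) X" for n
  define SZ where "SZ n = step_integral (N n) (p n) (c n) Z" for n
  note mem = partition_mem[OF p(1,2,3)]
  have Xm: "X r \<in> borel_measurable M" if "r \<in> {0..T}" for r
    using X that by (intro right_continuous_filtration_measurable[OF F, of r]) (auto simp: solves_sde_def)
  have Zm: "Z r \<in> borel_measurable M" if "r \<in> {0..T}" for r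
    using Z that by (intro right_continuous_filtration_measurable[OF F, of r]) (auto simp: standard_stable_levy_def)
  have [measurable]: "SX n \<in> borel_measurable M" "SZ n \<in> borel_measurable M" for n
    unfolding SX_def SZ_def step_integral_def[abs_def]
    by (auto intro!: borel_measurable_sum borel_measurable_times borel_measurable_diff Xm Zm mem)
  have [measurable]: "s n \<in> borel_measurable ?M" for n
    unfolding s_def by (intro measurable_restrict_space1) simp
  have fM [measurable]: "f \<in> borel_measurable ?M" by (intro measurable_restrict_space1) simp
  have LM: "(\<lambda>n. \<integral>\<^sup>+u. ennreal (\<bar>s n u - f u\<bar> powr \<alpha>) \<partial>?M) \<longlonglongrightarrow> 0"
    using L by (subst nn_integral_restrict_space) (auto simp: s_def mult.commute)
  have sB: "\<bar>s n x\<bar> \<le> (\<Sum>i<N n. \<bar>c n i\<bar>)" for n x unfolding s_def by (rule abs_step_fun_le)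
  have L1: "(\<lambda>n. LINT u|?M. \<bar>s n u - f u\<bar>) \<longlonglongrightarrow> 0"
    by (rule I.tendsto_L1_of_L_powr[OF \<alpha> _ sB fM fK LM]) measurable
  have L\<psi>: "(\<lambda>n. LINT x|?M. ?\<psi> (v * s n x)) \<longlonglongrightarrow> (LINT x|?M. ?\<psi> (v * f x))" for v
    by (rule I.tendsto_stable_exponent_of_L_powr[OF \<alpha> _ sB fM fK LM]) measurable
  define W where "W n \<omega> = SX n \<omega> - \<epsilon> * SZ n \<omega>" for n \<omega>
  have [measurable]: "W n \<in> borel_measurable M" for n unfolding W_def[abs_def] by measurable
  \<comment> \<open>A pointwise \<open>lim\<close> of measurable functions is measurable even where
    no limit exists; the pathwise drift integral, with which it agrees almost surely, is controlled
    only path by path.\<close>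
  define D where "D \<omega> = lim (\<lambda>n. W n \<omega>)" for \<omega>
  have [measurable]: "D \<in> borel_measurable M" unfolding D_def[abs_def] by (rule borel_measurable_lim_metric) measurable
  have "AE \<omega> in M. cadlag_on {0..T} (\<lambda>r. X r \<omega>)"
    and "AE \<omega> in M. \<forall>r\<in>{0..T}. X r \<omega> = x0 + (LINT s:{0..r}|lborel. \<theta> s * X s \<omega>) + \<epsilon> * Z r \<omega>"
    using X by (auto simp: solves_sde_def)
  then have AEW: "AE \<omega> in M. (\<lambda>n. W n \<omega>) \<longlonglongrightarrow> (LINT r:{0..T}|lborel. f r * (\<theta> r * X r \<omega>))"
  proof eventually_elim
    case (elim \<omega>)
    define g where "g r = \<theta> r * X r \<omega>" for r
    have g: "set_integrable lborel {0..T} g"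
      unfolding g_def by (rule cadlag_on_mult_integrable[OF elim(1) \<theta>])
    then have gM: "integrable ?M g"
      by (subst integrable_restrict_space) (auto simp: set_integrable_def)
    then have [measurable]: "g \<in> borel_measurable ?M" by auto
    obtain S1 where S1: "0 \<le> S1" "\<And>r. r \<in> {0..T} \<Longrightarrow> \<bar>X r \<omega>\<bar> \<le> S1" using cadlag_on_bounded[OF elim(1)] by blast
    have "bounded (\<theta> ` {0..T})" by (intro compact_imp_bounded compact_continuous_image \<theta>) simp
    then obtain S2 where "\<forall>y\<in>\<theta> ` {0..T}. norm y \<le> S2" unfolding bounded_iff by blast
    then have S2: "\<bar>\<theta> r\<bar> \<le> S2" if "r \<in> {0..T}" for r using that by auto
    \<comment> \<open>With a bounded drift density along the path, convergence of the step functions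
      in L^1 is enough for \<open>W n\<close>.\<close>
    have gS: "\<bar>g r\<bar> \<le> \<bar>S2\<bar> * S1" if "r \<in> {0..T}" for r
      unfolding g_def abs_mult using S1 S2[OF that] that by (intro mult_mono) auto
    have int_bounded: "integrable ?M (\<lambda>r. h r * g r)"
      if [measurable]: "h \<in> borel_measurable ?M" and h: "\<And>r. \<bar>h r\<bar> \<le> C" for h C
    proof (rule Bochner_Integration.integrable_bound)
      show "integrable ?M (\<lambda>r. C * g r)" using gM by simp
      show "AE r in ?M. norm (h r * g r) \<le> norm (C * g r)"
        using h by (intro AE_I2) (auto simp: abs_mult intro!: mult_right_mono order_trans[OF h abs_ge_self])
    qed measurable
    have W_eq: "W n \<omega> = (LINT r|?M. s n r * g r)" for n
    proof -
      have "W n \<omega> = (LINT r:{0..T}|lborel. s n r * g r)"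
        unfolding W_def SX_def SZ_def s_def
        by (rule step_integral_drift[OF p(1,2,3) g]) (use elim(2) in \<open>auto simp: g_def\<close>)
      then show ?thesis by (subst integral_restrict_space) (auto simp: set_lebesgue_integral_def)
    qed
    have target: "(LINT r:{0..T}|lborel. f r * g r) = (LINT r|?M. f r * g r)"
      by (subst integral_restrict_space) (auto simp: set_lebesgue_integral_def)
    have "(\<lambda>n. W n \<omega> - (LINT r|?M. f r * g r)) \<longlonglongrightarrow> 0"
    proof (rule Lim_null_comparison)
      show "(\<lambda>n. (\<bar>S2\<bar> * S1) * (LINT u|?M. \<bar>s n u - f u\<bar>)) \<longlonglongrightarrow> 0"
        using tendsto_mult[OF tendsto_const L1, of "\<bar>S2\<bar> * S1"] by simp
      show "\<forall>\<^sub>F n in sequentially. norm (W n \<omega> - (LINT r|?M. f r * g r)) \<le> (\<bar>S2\<bar> * S1) * (LINT u|?M. \<bar>s n u - f u\<bar>)"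
      proof (intro always_eventually allI)
        fix n
        have "W n \<omega> - (LINT r|?M. f r * g r) = (LINT r|?M. s n r * g r - f r * g r)"
          unfolding W_eq
          by (rule Bochner_Integration.integral_diff[symmetric]; rule int_bounded; (rule sB fK | measurable))
        also have "norm \<dots> \<le> (LINT r|?M. \<bar>s n r * g r - f r * g r\<bar>)"
          unfolding real_norm_def by (rule integral_abs_bound)
        also have "\<dots> \<le> (LINT r|?M. (\<bar>S2\<bar> * S1) * \<bar>s n r - f r\<bar>)"
        proof (rule integral_mono')
          have "integrable ?M (\<lambda>r. \<bar>s n r - f r\<bar>)"
            by (rule I.integrable_const_bound[of _ "(\<Sum>i<N n. \<bar>c n i\<bar>) + K"])
               (use sB[of n] fK in \<open>auto intro!: order_trans[OF abs_triangle_ineq4] add_mono\<close>)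
          then show "integrable ?M (\<lambda>r. (\<bar>S2\<bar> * S1) * \<bar>s n r - f r\<bar>)" by simp
          show "\<bar>s n r * g r - f r * g r\<bar> \<le> (\<bar>S2\<bar> * S1) * \<bar>s n r - f r\<bar>" if "r \<in> space ?M" for r
            using gS[of r] that unfolding left_diff_distrib[symmetric] abs_mult mult.commute[of "\<bar>s n r - f r\<bar>"]
            by (intro mult_right_mono) (simp_all add: abs_mult space_restrict_space)
        qed (use S1 in auto)
        finally show "norm (W n \<omega> - (LINT r|?M. f r * g r)) \<le> (\<bar>S2\<bar> * S1) * (LINT u|?M. \<bar>s n u - f u\<bar>)"
          by simp
      qed
    qed
    then show ?case using target by (simp add: LIM_zero_iff g_def)
  qed
  have AED: "AE \<omega> in M. (\<lambda>n. W n \<omega> - D \<omega>) \<longlonglongrightarrow> 0"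
    using AEW by eventually_elim (simp add: D_def limI LIM_zero_iff)
  have "char (distr M borel (\<lambda>\<omega>. Y \<omega> - D \<omega>)) u = exp (- (LINT x|?M. ?\<psi> (u * \<epsilon> * f x)))" for u
  proof -
    let ?c = "\<lambda>Y. char (distr M borel Y) u"
    \<comment> \<open>\<open>SX n - D\<close> is compared with two neighbours: with
      \<open>Y - D\<close> through convergence in probability, and with
      \<open>\<epsilon> * SZ n\<close> through the almost sure convergence of \<open>W n\<close> to
      \<open>D\<close>. The characteristic function of the second is explicit, which identifies that
      of the first.\<close>
    have 1: "(\<lambda>n. ?c (\<lambda>\<omega>. SX n \<omega> - D \<omega>) - ?c (\<lambda>\<omega>. Y \<omega> - D \<omega>)) \<longlonglongrightarrow> 0"
    proof (rule Lim_null_comparison[OF always_eventually[OF allI]])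
      show "cmod (?c (\<lambda>\<omega>. SX n \<omega> - D \<omega>) - ?c (\<lambda>\<omega>. Y \<omega> - D \<omega>))
          \<le> expectation (\<lambda>\<omega>. cmod (iexp (u * (SX n \<omega> - Y \<omega>)) - 1))" for n
        using norm_char_diff_le[of "\<lambda>\<omega>. SX n \<omega> - D \<omega>" "\<lambda>\<omega>. Y \<omega> - D \<omega>" u] by simp
      show "(\<lambda>n. expectation (\<lambda>\<omega>. cmod (iexp (u * (SX n \<omega> - Y \<omega>)) - 1))) \<longlonglongrightarrow> 0"
        using prob unfolding SX_def[symmetric] by (intro expectation_iexp_in_prob_tendsto_0) auto
    qed
    have 2: "(\<lambda>n. ?c (\<lambda>\<omega>. SX n \<omega> - D \<omega>) - ?c (\<lambda>\<omega>. \<epsilon> * SZ n \<omega>)) \<longlonglongrightarrow> 0"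
    proof (rule Lim_null_comparison[OF always_eventually[OF allI]])
      have eq: "SX n \<omega> - D \<omega> - \<epsilon> * SZ n \<omega> = W n \<omega> - D \<omega>" for n \<omega> by (simp add: W_def)
      show "cmod (?c (\<lambda>\<omega>. SX n \<omega> - D \<omega>) - ?c (\<lambda>\<omega>. \<epsilon> * SZ n \<omega>))
          \<le> expectation (\<lambda>\<omega>. cmod (iexp (u * (W n \<omega> - D \<omega>)) - 1))" for n
        using norm_char_diff_le[of "\<lambda>\<omega>. SX n \<omega> - D \<omega>" "\<lambda>\<omega>. \<epsilon> * SZ n \<omega>" u, unfolded eq] by simp
      show "(\<lambda>n. expectation (\<lambda>\<omega>. cmod (iexp (u * (W n \<omega> - D \<omega>)) - 1))) \<longlonglongrightarrow> 0"
        by (rule expectation_iexp_AE_tendsto_0[OF _ AED]) measurable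
    qed
    have "?c (\<lambda>\<omega>. \<epsilon> * SZ n \<omega>) = exp (- (LINT x|?M. ?\<psi> (u * \<epsilon> * s n x)))" for n
    proof -
      have "?c (\<lambda>\<omega>. \<epsilon> * SZ n \<omega>) = char (distr M borel (SZ n)) (u * \<epsilon>)"
        by (simp add: char_distr mult.assoc)
      also have "\<dots> = exp (- (LINT x|?M. ?\<psi> (u * \<epsilon> * s n x)))"
        unfolding SZ_def s_def using \<alpha> p
        by (subst char_step_integral_levy[OF F Z]) (auto simp: integral_stable_exponent_step_fun)
      finally show ?thesis .
    qed
    then have 3: "(\<lambda>n. ?c (\<lambda>\<omega>. \<epsilon> * SZ n \<omega>)) \<longlonglongrightarrow> exp (- (LINT x|?M. ?\<psi> (u * \<epsilon> * f x)))"
      by (simp only:) (intro tendsto_intros L\<psi>)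
    have "(\<lambda>n. ?c (\<lambda>\<omega>. SX n \<omega> - D \<omega>)) \<longlonglongrightarrow> exp (- (LINT x|?M. ?\<psi> (u * \<epsilon> * f x)))"
      using tendsto_add[OF 2 3] by simp
    moreover have "(\<lambda>n. ?c (\<lambda>\<omega>. SX n \<omega> - D \<omega>)) \<longlonglongrightarrow> ?c (\<lambda>\<omega>. Y \<omega> - D \<omega>)"
      using 1 by (simp only: LIM_zero_iff)
    ultimately show ?thesis using LIMSEQ_unique by blast
  qed
  moreover have "AE \<omega> in M. D \<omega> = (LINT r:{0..T}|lborel. f r * (\<theta> r * X r \<omega>))"
    using AEW by eventually_elim (simp add: D_def limI)
  ultimately show ?thesis using that[of D] by simp
qed

section \<open>The stochastic and the deterministic equation\<close>

lemma ode_solution_has_derivative: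
  assumes \<theta>: "continuous_on UNIV \<theta>" and s: "s \<in> {0..T}"
  shows "(ode_solution \<theta> x0 has_real_derivative \<theta> s * ode_solution \<theta> x0 s) (at s within {0..T})"
proof -
  have \<theta>': "continuous_on A \<theta>" for A by (rule continuous_on_subset[OF \<theta>]) simp
  have eq: "(LINT r:{0..s}|lborel. \<theta> r) = integral {0..s} \<theta>" for s
    by (rule set_borel_integral_eq_integral(2)[OF borel_integrable_atLeastAtMost'[OF \<theta>']])
  have "((\<lambda>s. LINT r:{0..s}|lborel. \<theta> r) has_real_derivative \<theta> s) (at s within {0..T})"
    unfolding eq by (rule integral_has_real_derivative[OF \<theta>' s])
  then show ?thesis unfolding ode_solution_def[abs_def]
    by (auto intro!: derivative_eq_intros)
qed

lemma ode_solution_integral_eq: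
  assumes \<theta>: "continuous_on UNIV \<theta>" and s: "0 \<le> s"
  shows "(LINT r:{0..s}|lborel. \<theta> r * ode_solution \<theta> x0 r) = ode_solution \<theta> x0 s - x0"
    and "continuous_on {0..s} (ode_solution \<theta> x0)"
proof -
  show cont: "continuous_on {0..s} (ode_solution \<theta> x0)"
    using ode_solution_has_derivative[OF \<theta>, of _ s] by (rule DERIV_continuous_on)
  have "(LINT r|lborel. indicator {0..s} r *\<^sub>R (\<theta> r * ode_solution \<theta> x0 r)) = ode_solution \<theta> x0 s - ode_solution \<theta> x0 0"
  proof (rule integral_FTC_Icc[OF s])
    show "(ode_solution \<theta> x0 has_vector_derivative \<theta> r * ode_solution \<theta> x0 r) (at r within {0..s})"
      if "0 \<le> r" "r \<le> s" for r
      using ode_solution_has_derivative[OF \<theta>, of r s] that by (simp add: has_real_derivative_iff_has_vector_derivative)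
    show "continuous_on {0..s} (\<lambda>r. \<theta> r * ode_solution \<theta> x0 r)"
      by (intro continuous_intros cont continuous_on_subset[OF \<theta>]) simp
  qed
  moreover have "ode_solution \<theta> x0 0 = x0"
    unfolding ode_solution_def
    by (subst set_borel_integral_eq_integral(2)[OF borel_integrable_atLeastAtMost'[OF continuous_on_subset[OF \<theta>]]]) auto
  ultimately show "(LINT r:{0..s}|lborel. \<theta> r * ode_solution \<theta> x0 r) = ode_solution \<theta> x0 s - x0"
    by (simp add: set_lebesgue_integral_def)
qed

text \<open>The derivative of the solution is the product itself, so regularity of order
  \<open>j\<close> of the product gives order \<open>j + 1\<close> of the solution. The induction
  therefore carries both functions along.\<close>

lemma ode_solution_continuously_differentiable:
  assumes \<theta>: "\<And>S. continuously_differentiable k \<theta> S" and c: "continuous_on UNIV \<theta>"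
  shows "continuously_differentiable k (\<lambda>s. \<theta> s * ode_solution \<theta> x0 s) {0<..<T}"
proof -
  have der: "(ode_solution \<theta> x0 has_real_derivative \<theta> s * ode_solution \<theta> x0 s) (at s)" if "s \<in> {0<..<T}" for s
  proof -
    have "at s within {0..T} = at s" using that by (intro at_within_interior) (simp add: interior_atLeastAtMost_real)
    then show ?thesis using ode_solution_has_derivative[OF c, of s T] that by simp
  qed
  have "continuously_differentiable j \<theta> S" if "j \<le> k" for j S
    using that by (induction rule: inc_induct) (assumption | rule \<theta> continuously_differentiable_SucD)+
  then have "continuously_differentiable j (\<lambda>s. \<theta> s * ode_solution \<theta> x0 s) {0<..<T} \<and>
      continuously_differentiable j (ode_solution \<theta> x0) {0<..<T}" if "j \<le> k" for j
    using that
  proof (induction j)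
    case 0
    have "continuous_on {0<..<T} (ode_solution \<theta> x0)" by (rule DERIV_continuous_on[OF has_field_derivative_at_within[OF der]])
    moreover have "continuous_on {0<..<T} \<theta>" using c continuous_on_subset by blast
    ultimately show ?case by (auto intro: continuous_on_mult)
  next
    case (Suc j)
    then have "continuously_differentiable (Suc j) (ode_solution \<theta> x0) {0<..<T}"
      using der by (auto intro!: exI[of _ "\<lambda>s. \<theta> s * ode_solution \<theta> x0 s"])
    then show ?case using Suc by (blast intro: continuously_differentiable_mult)
  qed
  then show ?thesis by blast
qed

section \<open>Small-noise deviation and change of variables\<close>

lemma sde_path_deviation:
  fixes X Z :: "real \<Rightarrow> real"
  assumes L: "0 < L" and \<epsilon>: "0 < \<epsilon>" and \<theta>: "continuous_on UNIV \<theta>" "\<And>s. s \<in> {0..T} \<Longrightarrow> \<bar>\<theta> s\<bar> \<le> L"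
    and X: "cadlag_on {0..T} X"
    and eq: "\<And>s. s \<in> {0..T} \<Longrightarrow> X s = x0 + (LINT r:{0..s}|lborel. \<theta> r * X r) + \<epsilon> * Z s"
    and S: "0 \<le> S" "\<And>s. s \<in> {0..T} \<Longrightarrow> \<bar>Z s\<bar> \<le> S" and s: "s \<in> {0..T}"
  shows "\<bar>X s - ode_solution \<theta> x0 s\<bar> \<le> 2 * (\<epsilon> * S) * exp (2 * L * T)"
proof -
  let ?x = "ode_solution \<theta> x0"
  have T: "0 \<le> T" using s by auto
  obtain B1 where B1: "\<And>s. s \<in> {0..T} \<Longrightarrow> \<bar>X s\<bar> \<le> B1" using cadlag_on_bounded[OF X] by blast
  have "bounded (?x ` {0..T})"
    by (intro compact_imp_bounded compact_continuous_image ode_solution_integral_eq(2) \<theta> T) simp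
  then obtain B2 where "\<forall>y\<in>?x ` {0..T}. norm y \<le> B2" unfolding bounded_iff by blast
  then have B2: "\<bar>?x s\<bar> \<le> B2" if "s \<in> {0..T}" for s using that by auto
  show ?thesis
  proof (rule gronwall_bounded[OF L _ \<theta>(2) _ _ s])
    show "0 \<le> \<epsilon> * S" using S \<epsilon> by simp
    show "\<bar>X s - ?x s\<bar> \<le> B1 + B2" if "s \<in> {0..T}" for s using B1[OF that] B2[OF that] by linarith
    fix s assume s: "s \<in> {0..T}"
    have cont: "continuous_on A \<theta>" for A using \<theta>(1) continuous_on_subset by blast
    have "set_integrable lborel {0..s} (\<lambda>r. \<theta> r * X r)"
      using s by (intro cadlag_on_mult_integrable cadlag_on_subset[OF X] cont) auto
    moreover have "set_integrable lborel {0..s} (\<lambda>r. \<theta> r * ?x r)"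
      using s by (intro borel_integrable_atLeastAtMost' continuous_intros cont ode_solution_integral_eq \<theta>) auto
    ultimately have "(LINT r:{0..s}|lborel. \<theta> r * (X r - ?x r))
        = (LINT r:{0..s}|lborel. \<theta> r * X r) - (LINT r:{0..s}|lborel. \<theta> r * ?x r)"
      by (simp add: right_diff_distrib set_integral_diff)
    then have "X s - ?x s = (LINT r:{0..s}|lborel. \<theta> r * (X r - ?x r)) + \<epsilon> * Z s"
      using eq[OF s] ode_solution_integral_eq(1)[OF \<theta>(1), of s x0] s by simp
    moreover have "\<bar>\<epsilon> * Z s\<bar> \<le> \<epsilon> * S" using \<epsilon> S(2)[OF s] by (simp add: abs_mult)
    ultimately show "\<bar>X s - ?x s\<bar> \<le> \<bar>LINT r:{0..s}|lborel. \<theta> r * (X r - ?x r)\<bar> + \<epsilon> * S" by linarith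
  qed
qed

text \<open>\<open>g\<close> receives both the rescaled and the original time, since the kernel is
  integrated against functions of the original one. The two inequalities place the window around
  \<open>t\<close> inside the time interval, so that truncation loses nothing.\<close>

lemma integral_kernel_rescale:
  fixes g :: "real \<Rightarrow> real \<Rightarrow> 'b::{banach, second_countable_topology}"
  assumes h: "0 < h" and supp: "\<And>u s. u \<notin> {A..B} \<Longrightarrow> g u s = 0"
    and "0 \<le> t + h * A" "t + h * B \<le> T"
  shows "(LINT s|lborel. indicator {0..T} s *\<^sub>R g ((s - t) / h) s) = h *\<^sub>R (LINT u|lborel. g u (t + h * u))"
proof -
  have "t + h * u \<in> {0..T}" if "u \<in> {A..B}" for u
  proof -
    have "h * A \<le> h * u" "h * u \<le> h * B" using that h by (auto intro: mult_left_mono)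
    then show ?thesis using assms(3,4) by simp
  qed
  then have "indicator {0..T} (t + h * u) *\<^sub>R g ((t + h * u - t) / h) (t + h * u) = g u (t + h * u)" for u
    using h supp[of u] by (cases "u \<in> {A..B}") auto
  then show ?thesis
    using h by (subst lborel_integral_real_affine[of h _ t]) auto
qed

section \<open>The limit theorem\<close>

text \<open>The first quotient is the size of the deviation of \<open>X\<close> from the
  deterministic solution relative to the rate, and vanishes with \<open>h\<close> because
  \<open>1 / \<alpha> < 1\<close>. The second is the factor in front of the noise; its power
  \<alpha> is \<open>1 / h\<close>, which cancels the Jacobian of the substitution.\<close>

lemma bandwidth_powr:
  fixes \<alpha> \<epsilon> :: real
  assumes \<alpha>: "1 < \<alpha>" and \<epsilon>: "0 < \<epsilon>" and \<gamma>: "\<gamma> = 1 / ((real k + 2) - 1 / \<alpha>)" and h: "h = \<epsilon> powr \<gamma>"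
  shows "0 < \<gamma>" "0 < h" "\<epsilon> / h ^ Suc k = h powr (1 - 1 / \<alpha>)" "\<epsilon> / h ^ Suc (Suc k) = h powr (- (1 / \<alpha>))"
proof -
  have "1 / \<alpha> < 1" using \<alpha> by simp
  then have pos: "0 < (real k + 2) - 1 / \<alpha>" by linarith
  then show "0 < \<gamma>" by (simp add: \<gamma>)
  show h0: "0 < h" using \<epsilon> by (simp add: h)
  have "\<epsilon> = h powr ((real k + 2) - 1 / \<alpha>)" using pos \<epsilon> by (simp add: h powr_powr \<gamma>)
  then have "\<epsilon> / h ^ j = h powr ((real k + 2) - 1 / \<alpha> - real j)" for j
    using h0 by (simp only: powr_diff powr_realpow)
  from this[of "Suc k"] this[of "Suc (Suc k)"]
  show "\<epsilon> / h ^ Suc k = h powr (1 - 1 / \<alpha>)" "\<epsilon> / h ^ Suc (Suc k) = h powr (- (1 / \<alpha>))"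
    by (simp_all add: algebra_simps)
qed

text \<open>Follows one path of the noise: the bound \<open>S\<close> does not depend on
  \<open>n\<close>, so the deviation from the deterministic solution is of order \<open>e n\<close>
  with a fixed constant.\<close>

lemma drift_term_tendsto:
  fixes X :: "nat \<Rightarrow> real \<Rightarrow> real" and Z G :: "real \<Rightarrow> real"
  assumes \<alpha>: "1 < \<alpha>" and L: "0 < L" and \<theta>: "\<And>S. continuously_differentiable (Suc k) \<theta> S"
    and \<theta>c: "continuous_on UNIV \<theta>" and \<theta>L: "\<And>s. s \<in> {0..T} \<Longrightarrow> \<bar>\<theta> s\<bar> \<le> L"
    and t: "0 < t" "t < T"
    and G [measurable]: "G \<in> borel_measurable borel" and K: "\<And>u. \<bar>G u\<bar> \<le> K"
    and supp: "\<And>u. u \<notin> {A..B} \<Longrightarrow> G u = 0"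
    and int1: "(LINT u|lborel. G u) = 1"
    and int0: "\<And>j. j \<in> {1..k} \<Longrightarrow> (LINT u|lborel. u ^ j * G u) = 0"
    and e: "\<And>n. 0 < e n" and \<gamma>: "\<gamma> = 1 / ((real k + 2) - 1 / \<alpha>)" and h: "\<And>n. h n = e n powr \<gamma>"
    and h_lim: "filterlim h (at_right 0) sequentially"
    and h_small: "\<forall>\<^sub>F n in sequentially. 0 \<le> t + h n * A \<and> t + h n * B \<le> T"
    and X: "\<And>n. cadlag_on {0..T} (X n)"
    and eq: "\<And>n s. s \<in> {0..T} \<Longrightarrow> X n s = x0 + (LINT r:{0..s}|lborel. \<theta> r * X n r) + e n * Z s"
    and S: "0 \<le> S" "\<And>s. s \<in> {0..T} \<Longrightarrow> \<bar>Z s\<bar> \<le> S"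
  defines "J \<equiv> \<lambda>s. \<theta> s * ode_solution \<theta> x0 s"
  shows "(\<lambda>n. ((LINT s:{0..T}|lborel. G ((s - t) / h n) * (\<theta> s * X n s)) / h n - J t) / h n ^ Suc k)
    \<longlonglongrightarrow> (deriv ^^ Suc k) J t / fact (Suc k) * (LINT u|lborel. G u * u ^ Suc k)"
proof -
  let ?x = "ode_solution \<theta> x0"
  note bw = bandwidth_powr[OF \<alpha> e \<gamma> h]
  define E where "E n = (LINT s:{0..T}|lborel. G ((s - t) / h n) * (\<theta> s * (X n s - ?x s)))" for n
  have Jsm: "continuously_differentiable (Suc k) J {0<..<T}"
    unfolding J_def by (rule ode_solution_continuously_differentiable[OF \<theta> \<theta>c])
  have bias: "(\<lambda>n. ((LINT u|lborel. G u * J (t + h n * u)) - J t) / h n ^ Suc k)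
      \<longlonglongrightarrow> (deriv ^^ Suc k) J t / fact (Suc k) * (LINT u|lborel. G u * u ^ Suc k)"
    by (rule filterlim_compose[OF kernel_bias[OF G K supp int1 int0 Jsm] h_lim]) (use t in auto)
  have \<theta>c': "continuous_on C \<theta>" for C using \<theta>c continuous_on_subset by blast
  have T: "0 \<le> T" using t by simp
  have split: "(LINT s:{0..T}|lborel. G ((s - t) / h n) * (\<theta> s * X n s))
      = (LINT s:{0..T}|lborel. G ((s - t) / h n) * J s) + E n" for n
  proof -
    have int: "set_integrable lborel {0..T} (\<lambda>s. G ((s - t) / h n) * g s)" if "set_integrable lborel {0..T} g" for g
    proof -
      have "integrable lborel (\<lambda>s. (indicator {0..T} s * G ((s - t) / h n)) * g s)"
        by (rule integrable_kernel_mult[where K = K and A = 0 and B = T])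
           (use K that order_trans[OF abs_ge_zero K] in \<open>auto simp: indicator_def abs_mult\<close>)
      then show ?thesis by (simp add: set_integrable_def mult.assoc)
    qed
    have 1: "set_integrable lborel {0..T} (\<lambda>s. \<theta> s * X n s)"
      by (rule cadlag_on_mult_integrable[OF X \<theta>c'])
    have 2: "set_integrable lborel {0..T} J"
      unfolding J_def by (intro borel_integrable_atLeastAtMost' continuous_intros \<theta>c' ode_solution_integral_eq \<theta>c T)
    have "set_integrable lborel {0..T} (\<lambda>s. \<theta> s * X n s - J s)" by (rule set_integral_diff(1)[OF 1 2])
    then have "set_integrable lborel {0..T} (\<lambda>s. \<theta> s * (X n s - ?x s))" by (simp add: J_def right_diff_distrib)
    from set_integral_add(2)[OF int[OF 2] int[OF this]] show ?thesis
      by (simp add: E_def J_def distrib_left[symmetric])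
  qed
  \<comment> \<open>The bound on \<theta>, the constant from Gronwall's inequality with
    \<open>e n\<close> taken out, and the mass of the kernel. A further factor \<open>h n\<close>
    comes from the substitution and cancels the division by the bandwidth.\<close>
  define C where "C = L * (2 * S * exp (2 * L * T)) * (LINT u|lborel. \<bar>G u\<bar>)"
  have "integrable lborel (\<lambda>u. G u * 1)"
    by (rule integrable_kernel_mult[OF G K supp]) (auto intro!: borel_integrable_atLeastAtMost')
  then have absG: "integrable lborel (\<lambda>u. \<bar>G u\<bar>)" by simp
  have E_le: "\<bar>E n\<bar> \<le> C * e n * h n" if n: "0 \<le> t + h n * A" "t + h n * B \<le> T" for n
  proof -
    let ?d = "L * (2 * (e n * S) * exp (2 * L * T))"
    have d0: "0 \<le> ?d" using L S e[of n] by simp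
    have "\<bar>E n\<bar> \<le> (LINT s|lborel. \<bar>indicator {0..T} s *\<^sub>R (G ((s - t) / h n) * (\<theta> s * (X n s - ?x s)))\<bar>)"
      unfolding E_def set_lebesgue_integral_def by (rule integral_abs_bound)
    also have "\<dots> \<le> (LINT s|lborel. ?d * (indicator {0..T} s *\<^sub>R \<bar>G ((s - t) / h n)\<bar>))"
    proof (rule integral_mono')
      have aff: "integrable lborel (\<lambda>s. \<bar>G ((s - t) / h n)\<bar>)"
        using lborel_integrable_real_affine[OF absG, of "1 / h n" "- t / h n"] bw(2)[of n]
        by (simp add: diff_divide_distrib)
      show "integrable lborel (\<lambda>s. ?d * (indicator {0..T} s *\<^sub>R \<bar>G ((s - t) / h n)\<bar>))"
        by (intro integrable_mult_right integrable_mult_indicator aff) simp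
      fix s
      show "\<bar>indicator {0..T} s *\<^sub>R (G ((s - t) / h n) * (\<theta> s * (X n s - ?x s)))\<bar>
          \<le> ?d * (indicator {0..T} s *\<^sub>R \<bar>G ((s - t) / h n)\<bar>)"
      proof (cases "s \<in> {0..T}")
        case True
        have "\<bar>X n s - ?x s\<bar> \<le> 2 * (e n * S) * exp (2 * L * T)"
          by (rule sde_path_deviation[OF L e \<theta>c \<theta>L X eq S True])
        then have "\<bar>\<theta> s\<bar> * \<bar>X n s - ?x s\<bar> \<le> ?d" using \<theta>L[OF True] L by (intro mult_mono) auto
        then have "\<bar>G ((s - t) / h n)\<bar> * (\<bar>\<theta> s\<bar> * \<bar>X n s - ?x s\<bar>) \<le> \<bar>G ((s - t) / h n)\<bar> * ?d"
          by (rule mult_left_mono) simp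
        then show ?thesis using True by (simp add: abs_mult mult.commute)
      qed simp
      show "0 \<le> ?d * (indicator {0..T} s *\<^sub>R \<bar>G ((s - t) / h n)\<bar>)" using d0 by simp
    qed
    also have "\<dots> = ?d * (h n * (LINT u|lborel. \<bar>G u\<bar>))"
      using integral_kernel_rescale[OF bw(2) _ n, of "\<lambda>u s. \<bar>G u\<bar>"] supp by simp
    finally show ?thesis by (simp add: C_def mult_ac)
  qed
  have "(\<lambda>n. E n / h n / h n ^ Suc k) \<longlonglongrightarrow> 0"
  proof (rule Lim_null_comparison)
    have "((\<lambda>x::real. x powr (1 - 1 / \<alpha>)) \<longlongrightarrow> 0 powr (1 - 1 / \<alpha>)) (at_right 0)"
      using \<alpha> by (intro tendsto_powr' tendsto_intros) (auto simp: eventually_at_right_less intro!: eventually_mono[OF eventually_at_right_less])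
    then have "(\<lambda>n. h n powr (1 - 1 / \<alpha>)) \<longlonglongrightarrow> 0" using h_lim by (auto intro: filterlim_compose)
    from tendsto_mult_left[OF this, of C] show "(\<lambda>n. C * h n powr (1 - 1 / \<alpha>)) \<longlonglongrightarrow> 0" by simp
    show "\<forall>\<^sub>F n in sequentially. norm (E n / h n / h n ^ Suc k) \<le> C * h n powr (1 - 1 / \<alpha>)"
      using h_small
    proof eventually_elim
      case (elim n)
      have hp: "0 < h n" "0 < h n ^ Suc k" using bw(2)[of n] by auto
      have "norm (E n / h n / h n ^ Suc k) = \<bar>E n\<bar> / h n / h n ^ Suc k"
        using hp by (simp only: real_norm_def abs_divide abs_of_pos)
      also have "\<dots> \<le> C * e n * h n / h n / h n ^ Suc k"
        using elim E_le[of n] hp by (intro divide_right_mono) auto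
      also have "\<dots> = C * (e n / h n ^ Suc k)" using hp(1) by simp
      finally show ?case unfolding bw(3) .
    qed
  qed
  from tendsto_add[OF bias this]
  have "(\<lambda>n. ((LINT u|lborel. G u * J (t + h n * u)) - J t) / h n ^ Suc k + E n / h n / h n ^ Suc k)
      \<longlonglongrightarrow> (deriv ^^ Suc k) J t / fact (Suc k) * (LINT u|lborel. G u * u ^ Suc k)" by simp
  moreover have "\<forall>\<^sub>F n in sequentially.
      ((LINT u|lborel. G u * J (t + h n * u)) - J t) / h n ^ Suc k + E n / h n / h n ^ Suc k
      = ((LINT s:{0..T}|lborel. G ((s - t) / h n) * (\<theta> s * X n s)) / h n - J t) / h n ^ Suc k"
    using h_small
  proof eventually_elim
    case (elim n)
    have "(LINT s:{0..T}|lborel. G ((s - t) / h n) * J s) = h n * (LINT u|lborel. G u * J (t + h n * u))"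
      using integral_kernel_rescale[OF bw(2)[of n], where A = A and B = B and t = t and T = T and g = "\<lambda>u s. G u * J s"] supp elim
      by (simp add: set_lebesgue_integral_def)
    then have "(LINT s:{0..T}|lborel. G ((s - t) / h n) * (\<theta> s * X n s)) / h n
        = (LINT u|lborel. G u * J (t + h n * u)) + E n / h n"
      unfolding split using bw(2)[of n] by (simp add: add_divide_distrib)
    then show ?case by (simp only: diff_divide_distrib add_divide_distrib)
  qed
  ultimately show ?thesis by (rule Lim_transform_eventually)
qed

lemma integral_stable_exponent_kernel:
  fixes G :: "real \<Rightarrow> real"
  assumes \<alpha>: "0 < \<alpha>" and G [measurable]: "G \<in> borel_measurable borel" and K: "\<And>u. \<bar>G u\<bar> \<le> K"
    and supp: "\<And>u. u \<notin> {A..B} \<Longrightarrow> G u = 0"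
  shows "(LINT v|lborel. stable_exponent \<alpha> \<kappa> (u * G v))
    = complex_of_real (LINT v|lborel. max (G v) 0 powr \<alpha>) * stable_exponent \<alpha> \<kappa> u
      + complex_of_real (LINT v|lborel. max (- G v) 0 powr \<alpha>) * stable_exponent \<alpha> \<kappa> (- u)"
proof -
  have int: "integrable lborel (\<lambda>v. max (g v) 0 powr \<alpha>)"
    if [measurable]: "g \<in> borel_measurable borel" and g: "\<And>v. \<bar>g v\<bar> \<le> K" "\<And>v. v \<notin> {A..B} \<Longrightarrow> g v = 0" for g
  proof (rule Bochner_Integration.integrable_bound)
    show "integrable lborel (\<lambda>v. indicator {A..B} v *\<^sub>R (K powr \<alpha>))"
      using borel_integrable_atLeastAtMost'[of A B "\<lambda>_. K powr \<alpha>"] by (simp add: set_integrable_def)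
    have "max (g v) 0 powr \<alpha> \<le> K powr \<alpha>" for v using g(1)[of v] \<alpha> by (intro powr_mono2) auto
    then show "AE v in lborel. norm (max (g v) 0 powr \<alpha>) \<le> norm (indicator {A..B} v *\<^sub>R (K powr \<alpha>))"
      using g(2) \<alpha> by (intro AE_I2) (auto simp: indicator_def)
  qed measurable
  \<comment> \<open>One of the two parts of \<open>G v\<close> is 0, and
    \<open>0 powr \<alpha> = 0\<close> removes its term; homogeneity gives the other.\<close>
  have pt: "stable_exponent \<alpha> \<kappa> (u * G v)
      = complex_of_real (max (G v) 0 powr \<alpha>) * stable_exponent \<alpha> \<kappa> u
        + complex_of_real (max (- G v) 0 powr \<alpha>) * stable_exponent \<alpha> \<kappa> (- u)" for v
    using stable_exponent_mult[of "G v" \<alpha> \<kappa> u] stable_exponent_mult[of "- G v" \<alpha> \<kappa> "- u"] \<alpha>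
    by (cases "0 \<le> G v") (auto simp: max_def mult.commute)
  have "integrable lborel (\<lambda>v. complex_of_real (max (G v) 0 powr \<alpha>))"
    "integrable lborel (\<lambda>v. complex_of_real (max (- G v) 0 powr \<alpha>))"
    using int[of G] int[of "\<lambda>v. - G v"] K supp by (auto intro!: integrable_of_real)
  then show ?thesis unfolding pt by simp
qed

text \<open>\<open>weak_conv_m\<close> speaks of sequences, so the limit in \<epsilon> is taken
  along every positive null sequence. The limit variables live on a space of their own, because only
  their law matters.\<close>

theorem theorem4p3:
  fixes M :: "'a measure" and F :: "real \<Rightarrow> 'a measure"
    and Z :: "real \<Rightarrow> 'a \<Rightarrow> real"
    and X :: "real \<Rightarrow> real \<Rightarrow> 'a \<Rightarrow> real"
    and estimator :: "real \<Rightarrow> 'a \<Rightarrow> real"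
    and N :: "'b measure" and U1 U2 :: "'b \<Rightarrow> real"
    and \<alpha> \<beta> T x0 L L' t \<gamma> m :: real
    and \<theta> G \<phi> x J :: "real \<Rightarrow> real"
    and k :: nat
  assumes alpha: "1 < \<alpha>" "\<alpha> < 2" and beta: "- 1 \<le> \<beta>" "\<beta> \<le> 1"
    and T: "0 < T" and L: "0 < L" "0 < L'"
    and M: "prob_space M" and F: "right_continuous_filtration M F"
    and Z: "standard_stable_levy M F \<alpha> \<beta> Z"
    and theta: "\<theta> \<in> Theta_class T L L' (k + 1)"
    and X: "\<And>\<epsilon>. 0 < \<epsilon> \<Longrightarrow> solves_sde M F T \<theta> x0 \<epsilon> Z (X \<epsilon>)"
    and x: "x = ode_solution \<theta> x0"
    and gamma: "\<gamma> = 1 / ((real k + 2) - 1 / \<alpha>)"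
    and phi: "\<And>\<epsilon>. 0 < \<epsilon> \<Longrightarrow> \<phi> \<epsilon> = \<epsilon> powr \<gamma>"
    and G: "kernel_A2 G" "kernel_A3 k G"
    and t: "0 < t" "t < T"
    and estimator: "\<And>\<epsilon>. 0 < \<epsilon> \<Longrightarrow> is_kernel_estimator M \<alpha> T G (\<phi> \<epsilon>) t (X \<epsilon>) (estimator \<epsilon>)"
    and J: "J = (\<lambda>s. \<theta> s * x s)"
    and m: "m = (deriv ^^ (k + 1)) J t / fact (k + 1) * (LINT u|lborel. G u * u ^ (k + 1))"
    and N: "prob_space N"
    and U1: "has_stable_law N U1 \<alpha> 1 \<beta> 0"
    and U2: "has_stable_law N U2 \<alpha> 1 \<beta> 0"
    and indep: "prob_space.indep_var N borel U1 borel U2"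
  shows "\<forall>e :: nat \<Rightarrow> real. (\<forall>n. 0 < e n) \<and> e \<longlonglongrightarrow> 0 \<longrightarrow>
           weak_conv_m
             (\<lambda>n. distr M borel
                (\<lambda>\<omega>. (estimator (e n) \<omega> - \<theta> t * x t) / \<phi> (e n) ^ (k + 1)))
             (distr N borel
                (\<lambda>\<omega>. (LINT u|lborel. max (G u) 0 powr \<alpha>) powr (1 / \<alpha>) * U1 \<omega>
                   - (LINT u|lborel. max (- G u) 0 powr \<alpha>) powr (1 / \<alpha>) * U2 \<omega> + m))"
proof (intro allI impI)
  fix e :: "nat \<Rightarrow> real" assume "(\<forall>n. 0 < e n) \<and> e \<longlonglongrightarrow> 0"
  then have e: "0 < e n" and e_lim: "e \<longlonglongrightarrow> 0" for n by auto
  interpret M: prob_space M by (rule M)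
  interpret N: prob_space N by (rule N)
  let ?\<psi> = "stable_exponent \<alpha> (\<beta> * tan (\<alpha> * pi / 2))"
  obtain A B where AB: "A < 0" "0 < B" "\<And>u. u < A \<or> B < u \<Longrightarrow> G u = 0" "(LINT u:{A..B}|lborel. G u) = 1"
    and Gm [measurable]: "G \<in> borel_measurable borel" and "bounded (range G)"
    using G(1) unfolding kernel_A2_def by blast
  then obtain K where K: "\<And>u. \<bar>G u\<bar> \<le> K" unfolding bounded_iff by auto
  have supp: "u \<notin> {A..B} \<Longrightarrow> G u = 0" for u using AB(3)[of u] by auto
  have "(\<lambda>u. indicator {A..B} u *\<^sub>R G u) = G" using supp by (auto simp: indicator_def fun_eq_iff)
  then have int1: "(LINT u|lborel. G u) = 1" using AB(4) by (simp add: set_lebesgue_integral_def)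
  have int0: "(LINT u|lborel. u ^ j * G u) = 0" if "j \<in> {1..k}" for j
    using G(2) that unfolding kernel_A3_def by blast
  have \<theta>: "continuously_differentiable (Suc k) \<theta> S" for S
    using Theta_class_continuously_differentiable[OF theta] by simp
  have \<theta>c: "continuous_on UNIV \<theta>"
    using continuously_differentiable_deriv(2)[OF \<theta>[of UNIV]] by (intro DERIV_continuous_on) auto
  have \<theta>L: "\<bar>\<theta> s\<bar> \<le> L" if "s \<in> {0..T}" for s using theta that by (auto simp: Theta_class_def)
  have \<theta>cT: "continuous_on {0..T} \<theta>" using \<theta>c continuous_on_subset by blast
  define h where "h n = e n powr \<gamma>" for n
  have \<phi>: "\<phi> (e n) = h n" for n by (simp add: h_def phi e)
  note bw = bandwidth_powr[OF alpha(1) e gamma h_def]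
  have "h \<longlonglongrightarrow> 0 powr \<gamma>"
    unfolding h_def[abs_def] using e less_imp_le by (intro tendsto_powr' e_lim tendsto_const) (use bw(1) in \<open>auto intro!: always_eventually less_imp_le e\<close>)
  then have h0: "h \<longlonglongrightarrow> 0" by simp
  have h_lim: "filterlim h (at_right 0) sequentially"
    unfolding filterlim_at using h0 bw(2) by (auto simp: less_imp_neq[symmetric])
  have h_small: "\<forall>\<^sub>F n in sequentially. 0 \<le> t + h n * A \<and> t + h n * B \<le> T"
  proof (intro eventually_conj)
    have lim: "(\<lambda>n. t + h n * c) \<longlonglongrightarrow> t" for c
      using tendsto_add[OF tendsto_const tendsto_mult_right[OF h0, of c], of t] by simp
    show "\<forall>\<^sub>F n in sequentially. 0 \<le> t + h n * A"
      using order_tendstoD(1)[OF lim[of A] t(1)] by (rule eventually_mono) simp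
    show "\<forall>\<^sub>F n in sequentially. t + h n * B \<le> T"
      using order_tendstoD(2)[OF lim[of B] t(2)] by (rule eventually_mono) simp
  qed
  have "\<exists>Y. has_stoch_integral M \<alpha> T (\<lambda>\<tau>. G ((\<tau> - t) / h n)) (X (e n)) Y \<and>
      (\<forall>\<omega>\<in>space M. estimator (e n) \<omega> = 1 / h n * Y \<omega>)" for n
    using estimator[OF e[of n]] unfolding is_kernel_estimator_def \<phi> .
  then obtain Y where Y: "\<And>n. has_stoch_integral M \<alpha> T (\<lambda>\<tau>. G ((\<tau> - t) / h n)) (X (e n)) (Y n)"
    and est: "\<And>n \<omega>. \<omega> \<in> space M \<Longrightarrow> estimator (e n) \<omega> = 1 / h n * Y n \<omega>" by metis
  have Ym [measurable]: "Y n \<in> borel_measurable M" for n using Y[of n] by (simp add: has_stoch_integral_def)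
  define P where "P n D \<longleftrightarrow> D \<in> borel_measurable M \<and>
    (AE \<omega> in M. D \<omega> = (LINT s:{0..T}|lborel. G ((s - t) / h n) * (\<theta> s * X (e n) s \<omega>))) \<and>
    (\<forall>u. char (distr M borel (\<lambda>\<omega>. Y n \<omega> - D \<omega>)) u = exp (- (LINT s|restrict_space lborel {0..T}.
        ?\<psi> (u * e n * G ((s - t) / h n)))))" for n D
  have "\<exists>D. P n D" for n
  proof (rule M.stoch_integral_split[OF F Z alpha(1) X[OF e] \<theta>cT _ _ Y[of n]])
    show "\<bar>G ((\<tau> - t) / h n)\<bar> \<le> K" for \<tau> by (rule K)
    show "(\<lambda>\<tau>. G ((\<tau> - t) / h n)) \<in> borel_measurable borel" by measurable
    fix D assume "D \<in> borel_measurable M"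
      "AE \<omega> in M. D \<omega> = (LINT s:{0..T}|lborel. G ((s - t) / h n) * (\<theta> s * X (e n) s \<omega>))"
      "\<And>u. char (distr M borel (\<lambda>\<omega>. Y n \<omega> - D \<omega>)) u = exp (- (LINT s|restrict_space lborel {0..T}.
        ?\<psi> (u * e n * G ((s - t) / h n))))"
    then show ?thesis unfolding P_def by (intro exI[of _ D] conjI allI)
  qed
  then obtain D where PD: "\<And>n. P n (D n)" by metis
  have Dm [measurable]: "D n \<in> borel_measurable M"
    and D: "AE \<omega> in M. D n \<omega> = (LINT s:{0..T}|lborel. G ((s - t) / h n) * (\<theta> s * X (e n) s \<omega>))"
    and charD: "char (distr M borel (\<lambda>\<omega>. Y n \<omega> - D n \<omega>)) u = exp (- (LINT s|restrict_space lborel {0..T}.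
        ?\<psi> (u * e n * G ((s - t) / h n))))" for n u
    using PD[of n] unfolding P_def by simp_all
  \<comment> \<open>One power of \<open>h n\<close> comes from the estimator and
    \<open>k + 1\<close> from the rate; \<open>R\<close> collects the drift together with the
    centring at \<open>J t\<close>.\<close>
  define V where "V n \<omega> = 1 / h n ^ Suc (Suc k) * (Y n \<omega> - D n \<omega>)" for n \<omega>
  define R where "R n \<omega> = (D n \<omega> / h n - J t) / h n ^ Suc k" for n \<omega>
  have [measurable]: "V n \<in> borel_measurable M" "R n \<in> borel_measurable M" for n
    unfolding V_def[abs_def] R_def[abs_def] by measurable
  have dec: "(estimator (e n) \<omega> - \<theta> t * x t) / \<phi> (e n) ^ (k + 1) = V n \<omega> + R n \<omega>" if "\<omega> \<in> space M" for n \<omega>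
    using bw(2)[of n] by (simp add: est[OF that] \<phi> V_def R_def J field_simps)
  have distr_eq: "distr M borel (\<lambda>\<omega>. (estimator (e n) \<omega> - \<theta> t * x t) / \<phi> (e n) ^ (k + 1)) = distr M borel (\<lambda>\<omega>. V n \<omega> + R n \<omega>)" for n
    by (rule distr_cong[OF refl refl dec])
  \<comment> \<open>Along a sequence the exceptional sets are countably many, so a single path can
    be followed through all \<open>n\<close>.\<close>
  have "AE \<omega> in M. \<forall>n. D n \<omega> = (LINT s:{0..T}|lborel. G ((s - t) / h n) * (\<theta> s * X (e n) s \<omega>))"
    using D by (simp add: AE_all_countable)
  moreover have "AE \<omega> in M. \<forall>n. cadlag_on {0..T} (\<lambda>s. X (e n) s \<omega>)"
    using X[OF e] by (simp add: AE_all_countable solves_sde_def)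
  moreover have "AE \<omega> in M. \<forall>n. \<forall>s\<in>{0..T}. X (e n) s \<omega> = x0 + (LINT r:{0..s}|lborel. \<theta> r * X (e n) r \<omega>) + e n * Z s \<omega>"
    using X[OF e] by (simp add: AE_all_countable solves_sde_def)
  moreover have "AE \<omega> in M. cadlag_on {0..} (\<lambda>s. Z s \<omega>)" using Z by (simp add: standard_stable_levy_def)
  ultimately have AER: "AE \<omega> in M. (\<lambda>n. R n \<omega> - m) \<longlonglongrightarrow> 0"
  proof eventually_elim
    case (elim \<omega>)
    obtain S where S: "0 \<le> S" "\<And>s. s \<in> {0..T} \<Longrightarrow> \<bar>Z s \<omega>\<bar> \<le> S"
      using cadlag_on_bounded[OF cadlag_on_subset[OF elim(4), of "{0..T}"]] by auto
    have "(\<lambda>n. ((LINT s:{0..T}|lborel. G ((s - t) / h n) * (\<theta> s * X (e n) s \<omega>)) / h n - \<theta> t * ode_solution \<theta> x0 t) / h n ^ Suc k)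
      \<longlonglongrightarrow> (deriv ^^ Suc k) (\<lambda>s. \<theta> s * ode_solution \<theta> x0 s) t / fact (Suc k) * (LINT u|lborel. G u * u ^ Suc k)"
      by (rule drift_term_tendsto[OF alpha(1) L(1) \<theta> \<theta>c \<theta>L t Gm K supp int1 int0 e gamma h_def h_lim h_small _ _ S])
         (use elim in auto)
    moreover have "(deriv ^^ Suc k) (\<lambda>s. \<theta> s * ode_solution \<theta> x0 s) t / fact (Suc k) * (LINT u|lborel. G u * u ^ Suc k) = m"
      unfolding m J x Suc_eq_plus1 ..
    ultimately have "(\<lambda>n. R n \<omega>) \<longlonglongrightarrow> m" unfolding R_def using elim(1) by (simp add: J x)
    then show ?case by (simp add: LIM_zero_iff)
  qed
  let ?target = "\<lambda>\<omega>. (LINT u|lborel. max (G u) 0 powr \<alpha>) powr (1 / \<alpha>) * U1 \<omega>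
                   - (LINT u|lborel. max (- G u) 0 powr \<alpha>) powr (1 / \<alpha>) * U2 \<omega> + m"
  have [measurable]: "U1 \<in> borel_measurable N" "U2 \<in> borel_measurable N"
    using U1 U2 by (auto simp: has_stable_law_def)
  have char_target: "char (distr N borel ?target) u = iexp (u * m) * exp (- (LINT v|lborel. ?\<psi> (u * G v)))" for u
  proof -
    define a where "a = (LINT u|lborel. max (G u) 0 powr \<alpha>) powr (1 / \<alpha>)"
    define b where "b = (LINT u|lborel. max (- G u) 0 powr \<alpha>) powr (1 / \<alpha>)"
    have ab: "a powr \<alpha> = (LINT u|lborel. max (G u) 0 powr \<alpha>)" "b powr \<alpha> = (LINT u|lborel. max (- G u) 0 powr \<alpha>)"
      using alpha by (simp_all add: a_def b_def powr_powr)
    have [simp]: "0 \<le> a" "0 \<le> b" by (simp_all add: a_def b_def)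
    \<comment> \<open>The minus sign is kept with \<open>U2\<close>: its exponent then appears at
      \<open>b * - u\<close>, the form that matches the negative part of the kernel.\<close>
    have "N.indep_var borel ((\<lambda>y. a * y) \<circ> U1) borel ((\<lambda>y. - b * y) \<circ> U2)"
      by (rule N.indep_var_compose[OF indep]) measurable
    then have ind: "N.indep_var borel (\<lambda>\<omega>. a * U1 \<omega>) borel (\<lambda>\<omega>. - b * U2 \<omega>)" by (simp add: comp_def)
    have "char (distr N borel ?target) u = iexp (u * m) * char (distr N borel (\<lambda>\<omega>. a * U1 \<omega> + - b * U2 \<omega>)) u"
      unfolding a_def[symmetric] b_def[symmetric]
      using N.char_distr_add_const[of "\<lambda>\<omega>. a * U1 \<omega> + - b * U2 \<omega>" m u] by simp
    also have "char (distr N borel (\<lambda>\<omega>. a * U1 \<omega> + - b * U2 \<omega>)) u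
        = char (distr N borel (\<lambda>\<omega>. a * U1 \<omega>)) u * char (distr N borel (\<lambda>\<omega>. - b * U2 \<omega>)) u"
      by (rule N.char_distr_add[OF ind])
    also have "char (distr N borel (\<lambda>\<omega>. a * U1 \<omega>)) u = exp (- ?\<psi> (a * u))"
      by (subst N.char_distr_mult) (auto simp: char_stable_law[OF U1] mult.commute)
    also have "char (distr N borel (\<lambda>\<omega>. - b * U2 \<omega>)) u = exp (- ?\<psi> (b * - u))"
      by (subst N.char_distr_mult) (auto simp: char_stable_law[OF U2] mult.commute)
    also have "exp (- ?\<psi> (a * u)) * exp (- ?\<psi> (b * - u)) = exp (- (LINT v|lborel. ?\<psi> (u * G v)))"
    proof -
      have "(LINT v|lborel. ?\<psi> (u * G v)) = ?\<psi> (a * u) + ?\<psi> (b * - u)"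
        unfolding stable_exponent_mult[OF \<open>0 \<le> a\<close>] stable_exponent_mult[OF \<open>0 \<le> b\<close>] ab
        using alpha by (intro integral_stable_exponent_kernel[OF _ Gm K supp]) auto
      then show ?thesis by (simp only: exp_add[symmetric] minus_add_distrib)
    qed
    finally show ?thesis .
  qed
  have charV: "\<forall>\<^sub>F n in sequentially. char (distr M borel (V n)) u = exp (- (LINT v|lborel. ?\<psi> (u * G v)))" for u
    using h_small
  proof eventually_elim
    case (elim n)
    let ?r = "e n / h n ^ Suc (Suc k)"
    have r0: "0 \<le> ?r" using e[of n] bw(2)[of n] by simp
    \<comment> \<open>This is where \<gamma> is exactly right: the Jacobian \<open>h n\<close> and
      the noise factor cancel, and no normalising constant is left in the limit law.\<close>
    have "?r powr \<alpha> = h n powr - 1" unfolding bw(4) powr_powr using alpha by simp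
    then have r: "h n * ?r powr \<alpha> = 1" using bw(2)[of n] by (simp add: powr_neg_one)
    have "char (distr M borel (V n)) u = char (distr M borel (\<lambda>\<omega>. Y n \<omega> - D n \<omega>)) (u * (1 / h n ^ Suc (Suc k)))"
      unfolding V_def[abs_def] by (rule M.char_distr_mult) measurable
    also have "\<dots> = exp (- (LINT s|restrict_space lborel {0..T}. ?\<psi> (?r * (u * G ((s - t) / h n)))))"
      unfolding charD by (simp add: mult_ac)
    also have "(LINT s|restrict_space lborel {0..T}. ?\<psi> (?r * (u * G ((s - t) / h n))))
        = (LINT s|lborel. indicator {0..T} s *\<^sub>R ?\<psi> (?r * (u * G ((s - t) / h n))))"
      by (rule integral_restrict_space) simp
    also have "\<dots> = h n *\<^sub>R (LINT v|lborel. ?\<psi> (?r * (u * G v)))"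
      using integral_kernel_rescale[OF bw(2)[of n], where A = A and B = B and t = t and T = T and g = "\<lambda>v s. ?\<psi> (?r * (u * G v))"] elim supp by simp
    also have "\<dots> = (h n * ?r powr \<alpha>) *\<^sub>R (LINT v|lborel. ?\<psi> (u * G v))"
      unfolding stable_exponent_mult[OF r0] by (simp add: scaleR_conv_of_real)
    finally show ?case unfolding r by simp
  qed
  show "weak_conv_m (\<lambda>n. distr M borel (\<lambda>\<omega>. (estimator (e n) \<omega> - \<theta> t * x t) / \<phi> (e n) ^ (k + 1))) (distr N borel ?target)"
    unfolding distr_eq
  proof (rule levy_continuity)
    show "real_distribution (distr M borel (\<lambda>\<omega>. V n \<omega> + R n \<omega>))" for n
      by (rule M.real_distribution_distr) measurable
    show "real_distribution (distr N borel ?target)" by (rule N.real_distribution_distr) measurable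
    fix u
    have 1: "(\<lambda>n. char (distr M borel (\<lambda>\<omega>. V n \<omega> + R n \<omega>)) u - char (distr M borel (\<lambda>\<omega>. V n \<omega> + m)) u) \<longlonglongrightarrow> 0"
    proof (rule Lim_null_comparison[OF always_eventually[OF allI]])
      show "cmod (char (distr M borel (\<lambda>\<omega>. V n \<omega> + R n \<omega>)) u - char (distr M borel (\<lambda>\<omega>. V n \<omega> + m)) u)
          \<le> M.expectation (\<lambda>\<omega>. cmod (iexp (u * (R n \<omega> - m)) - 1))" for n
        using M.norm_char_diff_le[of "\<lambda>\<omega>. V n \<omega> + R n \<omega>" "\<lambda>\<omega>. V n \<omega> + m" u] by simp
      show "(\<lambda>n. M.expectation (\<lambda>\<omega>. cmod (iexp (u * (R n \<omega> - m)) - 1))) \<longlonglongrightarrow> 0"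
        by (rule M.expectation_iexp_AE_tendsto_0[OF _ AER]) measurable
    qed
    have "\<forall>\<^sub>F n in sequentially. char (distr N borel ?target) u = char (distr M borel (\<lambda>\<omega>. V n \<omega> + m)) u"
      using charV[of u] by eventually_elim (simp add: M.char_distr_add_const char_target)
    then have "(\<lambda>n. char (distr M borel (\<lambda>\<omega>. V n \<omega> + m)) u) \<longlonglongrightarrow> char (distr N borel ?target) u"
      by (rule Lim_transform_eventually[OF tendsto_const])
    from tendsto_add[OF 1 this]
    show "(\<lambda>n. char (distr M borel (\<lambda>\<omega>. V n \<omega> + R n \<omega>)) u) \<longlonglongrightarrow> char (distr N borel ?target) u" by simp
  qed
qed

end
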